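(* Let $\chi:\mathbb{Z}^+\to\mathbb{R}^+$ be any function with $\chi(q)\to\infty$ as $q\to\infty$. Let $n\ge2$, $1\le m<n$, $k\ge2$ be integers, let $\Sigma\subset\mathbb{R}^n$ be a compact $m$-dimensional $C^k$ submanifold and $\varepsilon>0$. Then there is an $m$-dimensional $C^k$ submanifold $\Sigma'$ within $\varepsilon$ of $\Sigma$ in the $C^k$ topology and a strictly increasing sequence of positive integers $(q_M)_{M\ge1}$ (depending on $k,n,\varepsilon,\Sigma$) such that \[\Big|\Sigma'\cap\big(\tfrac{1}{q_M}\mathbb{Z}\big)^n\Big|\gtrsim\frac{q_M^{\frac{mn}{m+k(n-m)}}}{\chi(q_M)}\quad\text{for all }M.\] *)

theory Defs
  imports "HOL-Analysis.Analysis"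
begin

fun Ck_on :: "nat \<Rightarrow> 'a::euclidean_space set \<Rightarrow> ('a \<Rightarrow> 'b::real_normed_vector) \<Rightarrow> bool" where
  "Ck_on 0 S f = continuous_on S f"
| "Ck_on (Suc k) S f =
     (f differentiable_on S \<and> (\<forall>v. Ck_on k S (\<lambda>x. frechet_derivative f (at x) v)))"

fun dderiv :: "'a::real_normed_vector list \<Rightarrow> ('a \<Rightarrow> 'b::real_normed_vector) \<Rightarrow> 'a \<Rightarrow> 'b" where
  "dderiv [] f = f"
| "dderiv (v # vs) f = dderiv vs (\<lambda>x. frechet_derivative f (at x) v)"

definition Ck_diffeo :: "nat \<Rightarrow> 'a::euclidean_space set \<Rightarrow> 'a set \<Rightarrow> ('a \<Rightarrow> 'a) \<Rightarrow> bool" where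
  "Ck_diffeo k U V \<phi> \<longleftrightarrow> open U \<and> open V \<and> bij_betw \<phi> U V \<and>
     Ck_on k U \<phi> \<and> Ck_on k V (inv_into U \<phi>)"

definition Ck_submanifold :: "nat \<Rightarrow> nat \<Rightarrow> 'a::euclidean_space set \<Rightarrow> bool" where
  "Ck_submanifold k m S \<longleftrightarrow>
     (\<forall>p\<in>S. \<exists>U V \<phi> L. p \<in> U \<and> Ck_diffeo k U V \<phi> \<and> subspace L \<and> dim L = m \<and>
        \<phi> ` (U \<inter> S) = V \<inter> L)"

text \<open>S' is within eps of S in the C^k topology: S' is the image of S under a
  C^k diffeomorphism Phi of the ambient space whose difference from the identity
  has C^k norm (all derivatives of order 0..k, unit directions) less than eps.\<close>
definition Ck_close :: "nat \<Rightarrow> real \<Rightarrow> 'a::euclidean_space set \<Rightarrow> 'a set \<Rightarrow> bool" where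
  "Ck_close k eps S S' \<longleftrightarrow>
     (\<exists>\<Phi>. Ck_diffeo k UNIV UNIV \<Phi> \<and> \<Phi> ` S = S' \<and>
        (\<exists>\<delta><eps. \<forall>vs x. length vs \<le> k \<longrightarrow> (\<forall>v\<in>set vs. norm v \<le> 1) \<longrightarrow>
            norm (dderiv vs (\<lambda>y. \<Phi> y - y) x) \<le> \<delta>))"

definition rat_points :: "nat \<Rightarrow> (real^'n) set \<Rightarrow> (real^'n) set" where
  "rat_points q S = {x \<in> S. \<forall>i. \<exists>z::int. x $ i = real_of_int z / real q}"

end

theory Submission
  imports Defs "HOL-Computational_Algebra.Primes"
begin

text \<open>
  Some coordinate projection of \<open>\<Sigma>\<close> onto \<open>m\<close> coordinates \<open>I\<close> contains a box, so over it \<open>\<Sigma>\<close>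
  contains the graph of some function \<open>f\<close>, about which nothing else is needed. The perturbation is a
  shear \<open>y \<mapsto> y + G y\<close>, where \<open>G\<close> depends only on the coordinates in \<open>I\<close> and takes values in the
  remaining \<open>d = n - m\<close>, so it is a diffeomorphism with inverse \<open>y \<mapsto> y - G y\<close>.

  Fix a small box and a large \<open>q\<close>. Over the points of a rational grid add to \<open>f\<close> a small random
  affine map. The values modulo \<open>1/q\<close> are then pairwise independent and uniform, so in a positive
  proportion of cells of side \<open>r\<close> containing \<open>(qr)\<^sup>m\<close> grid points, one of the values lies within
  \<open>h\<close> of \<open>(1/q)\<int>\<^sup>d\<close> as soon as \<open>(qr)\<^sup>m (qh)\<^sup>d\<close> is of order 1. A bump of height \<open>h\<close> and radius \<open>r\<close> moves
  it there, at a cost \<open>h/r\<^sup>k\<close> in the \<open>C\<^sup>k\<close> norm. With \<open>h\<close> a small multiple of \<open>r\<^sup>k\<close> this gives of the order of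
  \<open>r\<^sup>-\<^sup>m = q\<^bsup>mn/(m+kd)\<^esup>\<close> rational points, with a constant that depends on the box and on the
  permitted size of the perturbation. Doing this in a sequence of disjoint boxes with summable
  perturbations, the constants are absorbed by \<open>\<chi>(q)\<close> if \<open>q\<close> is chosen large enough for each box.
\<close>

section \<open>Calculus of \<open>C\<^sup>k\<close> functions\<close>

lemma Ck_on_SucE:
  assumes "open S" "Ck_on (Suc k) S f"
  obtains f' where "\<And>x. x \<in> S \<Longrightarrow> (f has_derivative f' x) (at x)"
    "\<And>v. Ck_on k S (\<lambda>x. f' x v)"
proof
  show "(f has_derivative frechet_derivative f (at x)) (at x)" if "x \<in> S" for x
    using assms that
    by (auto simp: differentiable_on_eq_differentiable_at frechet_derivative_works[symmetric])
qed (use assms in simp)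

text \<open>\<open>Ck_on\<close> differentiates with \<open>at x\<close> in the whole space.
  Agreement on \<open>S\<close> carries over to derivatives because \<open>S\<close> is open: every
  point of it has a neighbourhood on which the two functions coincide.\<close>

lemma Ck_on_cong:
  assumes "open S" "\<And>x. x \<in> S \<Longrightarrow> f x = g x" "Ck_on k S f"
  shows "Ck_on k S g"
  using assms(2,3)
proof (induction k arbitrary: f g)
  case 0
  then show ?case by (simp cong: continuous_on_cong)
next
  case (Suc k)
  have d: "(g has_derivative frechet_derivative f (at x)) (at x)" if "x \<in> S" for x
  proof (rule has_derivative_transform_within_open)
    show "(f has_derivative frechet_derivative f (at x)) (at x)"
      using Suc.prems(2) that assms(1)
      by (auto simp: differentiable_on_eq_differentiable_at frechet_derivative_works[symmetric])
  qed (use assms(1) that Suc.prems in auto)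
  have "Ck_on k S (\<lambda>x. frechet_derivative g (at x) v)" for v
  proof (rule Suc.IH)
    show "frechet_derivative f (at x) v = frechet_derivative g (at x) v" if "x \<in> S" for x
      using frechet_derivative_at[OF d[OF that]] by simp
  qed (use Suc.prems in simp)
  moreover have "g differentiable_on S"
    using d assms(1) by (auto simp: differentiable_on_eq_differentiable_at differentiable_def)
  ultimately show ?case by simp
qed

text \<open>By uniqueness of derivatives any explicit \<open>f'\<close> may stand for
  \<open>frechet_derivative\<close>. Together with \<open>Ck_on_SucE\<close> this keeps the later
  inductions free of that choice operator.\<close>

lemma Ck_on_SucI:
  assumes "open S" "\<And>x. x \<in> S \<Longrightarrow> (f has_derivative f' x) (at x)"
    "\<And>v. Ck_on k S (\<lambda>x. f' x v)"
  shows "Ck_on (Suc k) S f"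
proof -
  have "Ck_on k S (\<lambda>x. frechet_derivative f (at x) v)" for v
    by (rule Ck_on_cong[OF assms(1) _ assms(3)[of v]])
      (metis assms(2) frechet_derivative_at)
  moreover have "f differentiable_on S"
    using assms by (auto simp: differentiable_on_eq_differentiable_at differentiable_def)
  ultimately show ?thesis by simp
qed

lemma Ck_on_SucD: "Ck_on (Suc k) S f \<Longrightarrow> Ck_on k S f"
proof (induction k arbitrary: f)
  case 0
  then show ?case by (simp add: differentiable_imp_continuous_on)
next
  case (Suc k)
  then show ?case by (metis Ck_on.simps(2))
qed

lemma Ck_on_subset: "Ck_on k S f \<Longrightarrow> T \<subseteq> S \<Longrightarrow> Ck_on k T f"
  by (induction k arbitrary: f) (auto intro: continuous_on_subset differentiable_on_subset)

lemma Ck_on_imp_continuous_on: "Ck_on k S f \<Longrightarrow> continuous_on S f"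
  by (induction k) (use Ck_on_SucD in auto)

lemma Ck_on_const: "Ck_on k S (\<lambda>x. c)"
  by (induction k arbitrary: c) auto

lemma Ck_on_bounded_linear:
  assumes "open S" "bounded_linear f"
  shows "Ck_on k S f"
proof (cases k)
  case 0
  then show ?thesis using assms by (simp add: linear_continuous_on)
next
  case (Suc j)
  then show ?thesis
    using Ck_on_SucI[OF assms(1), of f "\<lambda>x. f" j] assms(2) Ck_on_const
    by (auto intro: bounded_linear_imp_has_derivative)
qed

lemma Ck_on_add:
  assumes "open S" "Ck_on k S f" "Ck_on k S g"
  shows "Ck_on k S (\<lambda>x. f x + g x)"
  using assms(2,3)
proof (induction k arbitrary: f g)
  case 0
  then show ?case by (simp add: continuous_on_add)
next
  case (Suc k)
  from Ck_on_SucE[OF assms(1) Suc.prems(1)] obtain f' where f':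
    "\<And>x. x \<in> S \<Longrightarrow> (f has_derivative f' x) (at x)" "\<And>v. Ck_on k S (\<lambda>x. f' x v)" by blast
  from Ck_on_SucE[OF assms(1) Suc.prems(2)] obtain g' where g':
    "\<And>x. x \<in> S \<Longrightarrow> (g has_derivative g' x) (at x)" "\<And>v. Ck_on k S (\<lambda>x. g' x v)" by blast
  show ?case
    by (rule Ck_on_SucI[OF assms(1), where f'="\<lambda>x v. f' x v + g' x v"])
      (use f' g' Suc.IH in \<open>auto intro: has_derivative_add\<close>)
qed

lemma Ck_on_sum:
  assumes "open S" "\<And>i. i \<in> A \<Longrightarrow> Ck_on k S (f i)"
  shows "Ck_on k S (\<lambda>x. \<Sum>i\<in>A. f i x)"
  using assms(2)
  by (induction A rule: infinite_finite_induct) (auto simp: Ck_on_const intro!: Ck_on_add assms(1))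

text \<open>Product rule: the derivative contains \<open>a\<close> and \<open>f\<close> again, now
  to order \<open>k\<close> only, so the induction ranges over both factors.\<close>

lemma Ck_on_scaleR:
  fixes a :: "'a::euclidean_space \<Rightarrow> real"
  assumes "open S" "Ck_on k S a" "Ck_on k S f"
  shows "Ck_on k S (\<lambda>x. a x *\<^sub>R f x)"
  using assms(2,3)
proof (induction k arbitrary: a f)
  case 0
  then show ?case by (simp add: continuous_on_scaleR)
next
  case (Suc k)
  from Ck_on_SucE[OF assms(1) Suc.prems(1)] obtain a' where a':
    "\<And>x. x \<in> S \<Longrightarrow> (a has_derivative a' x) (at x)" "\<And>v. Ck_on k S (\<lambda>x. a' x v)" by blast
  from Ck_on_SucE[OF assms(1) Suc.prems(2)] obtain f' where f':
    "\<And>x. x \<in> S \<Longrightarrow> (f has_derivative f' x) (at x)" "\<And>v. Ck_on k S (\<lambda>x. f' x v)" by blast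
  show ?case
    by (rule Ck_on_SucI[OF assms(1), where f'="\<lambda>x v. a x *\<^sub>R f' x v + a' x v *\<^sub>R f x"])
      (use a' f' Suc.IH Suc.prems[THEN Ck_on_SucD] in
        \<open>auto intro!: has_derivative_scaleR Ck_on_add assms(1)\<close>)
qed

lemma linear_Basis_expansion:
  fixes h :: "'a::euclidean_space \<Rightarrow> 'b::real_vector"
  assumes "linear h"
  shows "h v = (\<Sum>b\<in>Basis. (v \<bullet> b) *\<^sub>R h b)"
proof -
  have "h v = h (\<Sum>b\<in>Basis. (v \<bullet> b) *\<^sub>R b)" by (simp add: euclidean_representation)
  then show ?thesis using assms by (simp add: linear_sum linear_cmul)
qed

lemma Ck_on_linear_image:
  assumes "open S" "bounded_linear h" "Ck_on k S f"
  shows "Ck_on k S (\<lambda>x. h (f x))"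
  using assms(3)
proof (induction k arbitrary: f)
  case 0
  then show ?case
    using bounded_linear.continuous_on[OF assms(2)] by auto
next
  case (Suc k)
  from Ck_on_SucE[OF assms(1) Suc.prems] obtain f' where f':
    "\<And>x. x \<in> S \<Longrightarrow> (f has_derivative f' x) (at x)" "\<And>v. Ck_on k S (\<lambda>x. f' x v)" by blast
  show ?case
    by (rule Ck_on_SucI[OF assms(1), where f'="\<lambda>x v. h (f' x v)"])
      (use f' Suc.IH in \<open>auto intro: bounded_linear.has_derivative[OF assms(2)]\<close>)
qed

lemma Ck_on_compose:
  fixes f :: "'a::euclidean_space \<Rightarrow> 'b::euclidean_space" and g :: "'b \<Rightarrow> 'c::real_normed_vector"
  assumes "open S" "open T" "f ` S \<subseteq> T" "Ck_on k S f" "Ck_on k T g"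
  shows "Ck_on k S (\<lambda>x. g (f x))"
  using assms(4,5)
proof (induction k arbitrary: g)
  case 0
  then show ?case using assms(3) by (auto intro: continuous_on_compose2)
next
  case (Suc k)
  from Ck_on_SucE[OF assms(1) Suc.prems(1)] obtain f' where f':
    "\<And>x. x \<in> S \<Longrightarrow> (f has_derivative f' x) (at x)" "\<And>v. Ck_on k S (\<lambda>x. f' x v)" by blast
  from Ck_on_SucE[OF assms(2) Suc.prems(2)] obtain g' where g':
    "\<And>x. x \<in> T \<Longrightarrow> (g has_derivative g' x) (at x)" "\<And>v. Ck_on k T (\<lambda>x. g' x v)" by blast
  \<comment> \<open>The direction \<open>f' x v\<close> varies with \<open>x\<close>, while
    \<open>Ck_on\<close> speaks of fixed directions. Expanding it in the basis turns the derivative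
    of the composition into a finite sum of products, to which the induction hypothesis applies with
    \<open>g' _ b\<close> in place of \<open>g\<close>.\<close>
  have expand: "(\<Sum>b\<in>Basis. (f' x v \<bullet> b) *\<^sub>R g' (f x) b) = g' (f x) (f' x v)" if "x \<in> S" for x v
  proof -
    have "linear (g' (f x))"
      using g'(1) assms(3) that by (blast dest: has_derivative_linear)
    then show ?thesis by (rule linear_Basis_expansion[symmetric])
  qed
  show ?case
  proof (rule Ck_on_SucI[OF assms(1), where f'="\<lambda>x v. g' (f x) (f' x v)"])
    show "((\<lambda>x. g (f x)) has_derivative (\<lambda>v. g' (f x) (f' x v))) (at x)" if "x \<in> S" for x
      using has_derivative_compose[OF f'(1)[OF that]] g'(1) assms(3) that by blast
    show "Ck_on k S (\<lambda>x. g' (f x) (f' x v))" for v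
    proof (rule Ck_on_cong[OF assms(1) expand[of _ v]])
      have "Ck_on k S (\<lambda>x. f' x v \<bullet> b)" for b
        using Ck_on_linear_image[OF assms(1) bounded_linear_inner_left f'(2)] .
      then show "Ck_on k S (\<lambda>x. \<Sum>b\<in>Basis. (f' x v \<bullet> b) *\<^sub>R g' (f x) b)"
        by (intro Ck_on_sum Ck_on_scaleR assms(1) Suc.IH g' Ck_on_SucD[OF Suc.prems(1)])
    qed
  qed
qed


section \<open>Uniform bounds on a function and its derivatives up to order k\<close>

text \<open>An upper bound for the C^k norm over the whole space. The factor \<open>norm v\<close>
  makes an iterated derivative of order at most \<open>k\<close> bounded by \<open>C\<close> times
  the product of the norms of its directions, a condition that passes through the recursion.\<close>

fun Ck_bound :: "nat \<Rightarrow> real \<Rightarrow> ('a::euclidean_space \<Rightarrow> 'b::real_normed_vector) \<Rightarrow> bool" where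
  "Ck_bound 0 C f = (continuous_on UNIV f \<and> (\<forall>x. norm (f x) \<le> C))"
| "Ck_bound (Suc k) C f =
     (f differentiable_on UNIV \<and> (\<forall>x. norm (f x) \<le> C) \<and>
      (\<forall>v. Ck_bound k (C * norm v) (\<lambda>x. frechet_derivative f (at x) v)))"

lemma Ck_bound_SucE:
  assumes "Ck_bound (Suc k) C f"
  obtains f' where "\<And>x. (f has_derivative f' x) (at x)" "\<And>x. norm (f x) \<le> C"
    "\<And>v. Ck_bound k (C * norm v) (\<lambda>x. f' x v)"
proof
  show "(f has_derivative frechet_derivative f (at x)) (at x)" for x
    using assms
    by (auto simp: differentiable_on_eq_differentiable_at frechet_derivative_works[symmetric])
qed (use assms in auto)

lemma Ck_bound_SucI:
  assumes d: "\<And>x. (f has_derivative f' x) (at x)" and "\<And>x. norm (f x) \<le> C"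
    and b: "\<And>v. Ck_bound k (C * norm v) (\<lambda>x. f' x v)"
  shows "Ck_bound (Suc k) C f"
proof -
  have "frechet_derivative f (at x) = f' x" for x
    using frechet_derivative_at[OF d[of x]] by simp
  moreover have "f differentiable_on UNIV"
    using d by (auto simp: differentiable_on_eq_differentiable_at differentiable_def)
  ultimately show ?thesis
    using assms by simp
qed

lemma Ck_bound_imp_Ck_on: "Ck_bound k C f \<Longrightarrow> Ck_on k UNIV f"
  by (induction k arbitrary: C f) auto

lemma Ck_bound_norm_le: "Ck_bound k C f \<Longrightarrow> norm (f x) \<le> C"
  by (cases k) auto

lemma Ck_bound_nonneg: "Ck_bound k C f \<Longrightarrow> 0 \<le> C"
  using Ck_bound_norm_le norm_ge_zero order_trans by blast

text \<open>The recursion of \<open>Ck_bound\<close> matches that of \<open>dderiv\<close>. For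
  directions of norm at most 1 this yields the bound that \<open>Ck_close\<close> asks for.\<close>

lemma Ck_bound_dderiv:
  assumes "Ck_bound k C f" "length vs \<le> k"
  shows "norm (dderiv vs f x) \<le> C * prod_list (map norm vs)"
  using assms
proof (induction vs arbitrary: k C f)
  case Nil
  then show ?case by (simp add: Ck_bound_norm_le)
next
  case (Cons v vs)
  then obtain j where [simp]: "k = Suc j" by (cases k) auto
  have "norm (dderiv vs (\<lambda>x. frechet_derivative f (at x) v) x)
      \<le> C * norm v * prod_list (map norm vs)"
    using Cons.prems by (intro Cons.IH[of j]) auto
  then show ?case by (simp add: mult_ac)
qed

lemma Ck_bound_mono: "Ck_bound k C f \<Longrightarrow> C \<le> D \<Longrightarrow> Ck_bound k D f"
proof (induction k arbitrary: C D f)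
  case 0
  then show ?case by (auto intro: order_trans)
next
  case (Suc k)
  then show ?case
    by (auto intro: order_trans Suc.IH[OF _ mult_right_mono])
qed

lemma Ck_bound_zero: "0 \<le> C \<Longrightarrow> Ck_bound k C (\<lambda>x. 0)"
  by (induction k arbitrary: C) auto

lemma Ck_bound_add:
  assumes "Ck_bound k C f" "Ck_bound k D g"
  shows "Ck_bound k (C + D) (\<lambda>x. f x + g x)"
  using assms
proof (induction k arbitrary: C D f g)
  case 0
  then show ?case by (auto intro: continuous_on_add norm_triangle_mono)
next
  case (Suc k)
  from Ck_bound_SucE[OF Suc.prems(1)] obtain f' where f':
    "\<And>x. (f has_derivative f' x) (at x)" "\<And>x. norm (f x) \<le> C"
    "\<And>v. Ck_bound k (C * norm v) (\<lambda>x. f' x v)" by blast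
  from Ck_bound_SucE[OF Suc.prems(2)] obtain g' where g':
    "\<And>x. (g has_derivative g' x) (at x)" "\<And>x. norm (g x) \<le> D"
    "\<And>v. Ck_bound k (D * norm v) (\<lambda>x. g' x v)" by blast
  show ?case
    by (rule Ck_bound_SucI[where f'="\<lambda>x v. f' x v + g' x v"])
      (use f' g' Suc.IH in \<open>auto intro: has_derivative_add norm_triangle_mono simp: distrib_right\<close>)
qed

lemma Ck_bound_sum:
  assumes "\<And>i. i \<in> A \<Longrightarrow> Ck_bound k (C i) (f i)"
  shows "Ck_bound k (\<Sum>i\<in>A. C i) (\<lambda>x. \<Sum>i\<in>A. f i x)"
  using assms
  by (induction A rule: infinite_finite_induct) (auto simp: Ck_bound_zero intro!: Ck_bound_add)

lemma Ck_bound_linear_image: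
  assumes "bounded_linear h" "\<And>y. norm (h y) \<le> L * norm y" "0 \<le> L" "Ck_bound k C f"
  shows "Ck_bound k (L * C) (\<lambda>x. h (f x))"
  using assms(4)
proof (induction k arbitrary: C f)
  case 0
  then have "norm (h (f x)) \<le> L * C" for x
    using assms(2)[of "f x"] mult_left_mono[of "norm (f x)" C L] assms(3) order_trans
    by (metis Ck_bound.simps(1))
  then show ?case using 0 bounded_linear.continuous_on[OF assms(1)] by auto
next
  case (Suc k)
  from Ck_bound_SucE[OF Suc.prems(1)] obtain f' where f':
    "\<And>x. (f has_derivative f' x) (at x)" "\<And>x. norm (f x) \<le> C"
    "\<And>v. Ck_bound k (C * norm v) (\<lambda>x. f' x v)" by blast
  show ?case
  proof (rule Ck_bound_SucI[where f'="\<lambda>x v. h (f' x v)"])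
    show "norm (h (f x)) \<le> L * C" for x
      using assms(2)[of "f x"] mult_left_mono[OF f'(2) assms(3)] order_trans by blast
  qed (use f' Suc.IH in \<open>auto intro: bounded_linear.has_derivative[OF assms(1)] simp: mult.assoc\<close>)
qed

lemma Ck_bound_scaleR_const:
  "Ck_bound k C f \<Longrightarrow> Ck_bound k (\<bar>c\<bar> * C) (\<lambda>x. c *\<^sub>R f x)"
  by (rule Ck_bound_linear_image) (auto intro: bounded_linear_scaleR_right)

lemma Ck_bound_scaleR_vector:
  fixes f :: "'a::euclidean_space \<Rightarrow> real"
  shows "Ck_bound k C f \<Longrightarrow> Ck_bound k (norm w * C) (\<lambda>x. f x *\<^sub>R w)"
  by (rule Ck_bound_linear_image) (auto intro: bounded_linear_scaleR_left)

text \<open>Each differentiation brings out one factor \<open>R\<close>, hence one factor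
  \<open>L\<close>. As \<open>1 \<le> L\<close>, the power \<open>L ^ k\<close> serves for all
  orders.\<close>

lemma Ck_bound_compose_affine:
  assumes "bounded_linear R" "\<And>v. norm (R v) \<le> L * norm v" "1 \<le> L" "Ck_bound k C f"
  shows "Ck_bound k (C * L ^ k) (\<lambda>x. f (R x + a))"
  using assms(4)
proof (induction k arbitrary: C f)
  case 0
  have "continuous_on UNIV (\<lambda>x. R x + a)"
    using assms(1) by (intro continuous_intros linear_continuous_on)
  with 0 show ?case by (auto intro: continuous_on_compose2)
next
  case (Suc k)
  from Ck_bound_SucE[OF Suc.prems(1)] obtain f' where f':
    "\<And>x. (f has_derivative f' x) (at x)" "\<And>x. norm (f x) \<le> C"
    "\<And>v. Ck_bound k (C * norm v) (\<lambda>x. f' x v)" by blast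
  have C: "0 \<le> C" using Ck_bound_nonneg[OF Suc.prems] .
  show ?case
  proof (rule Ck_bound_SucI[where f'="\<lambda>x v. f' (R x + a) (R v)"])
    show "((\<lambda>x. f (R x + a)) has_derivative (\<lambda>v. f' (R x + a) (R v))) (at x)" for x
    proof -
      have "((\<lambda>x. R x + a) has_derivative R) (at x)"
        using bounded_linear_imp_has_derivative[OF assms(1)]
        by (auto intro!: derivative_eq_intros)
      from has_derivative_compose[OF this f'(1)] show ?thesis .
    qed
    show "norm (f (R x + a)) \<le> C * L ^ Suc k" for x
      using f'(2)[of "R x + a"] C mult_left_mono[OF one_le_power[OF assms(3), of "Suc k"] C]
      by simp
    show "Ck_bound k (C * L ^ Suc k * norm v) (\<lambda>x. f' (R x + a) (R v))" for v
    proof (rule Ck_bound_mono[OF Suc.IH[OF f'(3)]])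
      have "C * norm (R v) * L ^ k \<le> C * (L * norm v) * L ^ k"
        using C assms(2,3) by (intro mult_left_mono mult_right_mono) auto
      then show "C * norm (R v) * L ^ k \<le> C * L ^ Suc k * norm v"
        by (simp add: mult_ac)
    qed
  qed
qed

lemma has_derivative_eq_zero_on_open:
  assumes "(f has_derivative f') (at x)" "open T" "x \<in> T" "\<And>y. y \<in> T \<Longrightarrow> f y = 0"
  shows "f' = (\<lambda>v. 0)"
proof (rule has_derivative_unique[OF assms(1)])
  show "(f has_derivative (\<lambda>v. 0)) (at x)"
    by (rule has_derivative_transform_within_open[OF has_derivative_const[of 0] assms(2,3)])
      (use assms(4) in auto)
qed

text \<open>Near each point at most one summand is not identically zero, so the bound does not grow
  with the number of summands. Vanishing is required on a neighbourhood so that the hypothesis is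
  inherited by the derivatives.\<close>

lemma Ck_bound_disjoint_sum:
  fixes f :: "'a \<Rightarrow> 'b::euclidean_space \<Rightarrow> 'c::real_normed_vector"
  assumes "finite A" "0 \<le> C" "\<And>i. i \<in> A \<Longrightarrow> Ck_bound k C (f i)"
    and "\<And>x. \<exists>i. \<forall>j\<in>A - {i}. \<exists>T. open T \<and> x \<in> T \<and> (\<forall>y\<in>T. f j y = 0)"
  shows "Ck_bound k C (\<lambda>x. \<Sum>i\<in>A. f i x)"
proof -
  have norm_le: "norm (\<Sum>i\<in>A. f i x) \<le> C"
    if "0 \<le> C" and bound: "\<And>i x. i \<in> A \<Longrightarrow> norm (f i x) \<le> C"
      and vanish: "\<And>x. \<exists>i. \<forall>j\<in>A - {i}. \<exists>T. open T \<and> x \<in> T \<and> (\<forall>y\<in>T. f j y = 0)"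
    for C x and f :: "'a \<Rightarrow> 'b \<Rightarrow> 'c"
  proof -
    obtain i where i: "\<forall>j\<in>A - {i}. \<exists>T. open T \<and> x \<in> T \<and> (\<forall>y\<in>T. f j y = 0)"
      using vanish by blast
    have "(\<Sum>j\<in>A. f j x) = (\<Sum>j\<in>A \<inter> {i}. f j x)"
      by (rule sum.mono_neutral_right) (use i assms(1) in auto)
    then show ?thesis using \<open>0 \<le> C\<close> bound by (cases "i \<in> A") auto
  qed
  show ?thesis
    using assms(2-)
  proof (induction k arbitrary: C f)
    case (0 C f)
    have "norm (\<Sum>i\<in>A. f i x) \<le> C" for x
      by (rule norm_le[OF 0(1) Ck_bound_norm_le[OF 0(2)] 0(3)])
    moreover have "continuous_on UNIV (\<lambda>x. \<Sum>i\<in>A. f i x)"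
      using 0 by (intro continuous_on_sum) auto
    ultimately show ?case by simp
  next
    case (Suc k C f)
    have "norm (\<Sum>i\<in>A. f i x) \<le> C" for x
      by (rule norm_le[OF Suc.prems(1) Ck_bound_norm_le[OF Suc.prems(2)] Suc.prems(3)])
    moreover have "\<exists>f'. (\<forall>x. (f i has_derivative f' x) (at x)) \<and>
        (\<forall>v. Ck_bound k (C * norm v) (\<lambda>x. f' x v))" if "i \<in> A" for i
      using Ck_bound_SucE[OF Suc.prems(2)[OF that]] by metis
    then obtain f' where f': "\<And>i x. i \<in> A \<Longrightarrow> (f i has_derivative f' i x) (at x)"
      "\<And>i v. i \<in> A \<Longrightarrow> Ck_bound k (C * norm v) (\<lambda>x. f' i x v)" by metis
    moreover have "Ck_bound k (C * norm v) (\<lambda>x. \<Sum>i\<in>A. f' i x v)" for v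
    proof (rule Suc.IH)
      show "\<exists>i. \<forall>j\<in>A - {i}. \<exists>T. open T \<and> x \<in> T \<and> (\<forall>y\<in>T. f' j y v = 0)" for x
      proof -
        obtain i where i: "\<forall>j\<in>A - {i}. \<exists>T. open T \<and> x \<in> T \<and> (\<forall>y\<in>T. f j y = 0)"
          using Suc.prems by blast
        have "\<exists>T. open T \<and> x \<in> T \<and> (\<forall>y\<in>T. f' j y v = 0)" if j: "j \<in> A - {i}" for j
        proof -
          obtain T where T: "open T" "x \<in> T" "\<forall>y\<in>T. f j y = 0"
            using i j by blast
          have "f' j y = (\<lambda>v. 0)" if "y \<in> T" for y
            using has_derivative_eq_zero_on_open[OF f'(1) T(1) that] j T by blast
          with T show ?thesis by metis
        qed
        then show ?thesis by blast
      qed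
    qed (use f' Suc.prems in auto)
    ultimately show ?case
      by (intro Ck_bound_SucI[where f'="\<lambda>x v. \<Sum>i\<in>A. f' i x v"] has_derivative_sum) auto
  qed
qed

text \<open>Continuity on the closed ball gives a bound, and the derivatives again vanish outside
  it. The induction bounds each directional derivative separately; expanding \<open>v\<close> in the
  basis makes the bound linear in \<open>norm v\<close>.\<close>

lemma Ck_bound_compact_support:
  assumes "Ck_on k UNIV f" "\<And>x. r < norm x \<Longrightarrow> f x = 0"
  shows "\<exists>C. Ck_bound k C f"
  using assms
proof (induction k arbitrary: f)
  case (0 f)
  have "bounded (f ` cball 0 r)"
    using 0 by (intro compact_imp_bounded compact_continuous_image)
      (auto intro: continuous_on_subset)
  then obtain B where B: "\<And>x. norm x \<le> r \<Longrightarrow> norm (f x) \<le> B"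
    unfolding bounded_iff by (metis imageI mem_cball_0)
  have "norm (f x) \<le> max B 0" for x
    using B[of x] 0(2)[of x] by (cases "norm x \<le> r") auto
  then show ?case using 0 by auto
next
  case (Suc k f)
  from Ck_on_SucE[OF open_UNIV Suc.prems(1)] obtain f' where
    "\<And>x. x \<in> UNIV \<Longrightarrow> (f has_derivative f' x) (at x)" "\<And>v. Ck_on k UNIV (\<lambda>x. f' x v)" by blast
  note f' = this(1)[OF UNIV_I] this(2)
  have "\<exists>C. Ck_bound k C (\<lambda>x. f' x v)" for v
  proof (rule Suc.IH[OF f'(2)])
    fix x :: 'a assume x: "r < norm x"
    have "f' x = (\<lambda>v. 0)"
    proof (rule has_derivative_eq_zero_on_open[OF f'(1)])
      show "open (- cball (0::'a) r)" by auto
    qed (use x Suc.prems(2) in auto)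
    then show "f' x v = 0" by simp
  qed
  then obtain C where C: "\<And>v. Ck_bound k (C v) (\<lambda>x. f' x v)" by metis
  have "bounded (f ` cball 0 r)"
    using Suc.prems(1)[THEN Ck_on_imp_continuous_on]
    by (intro compact_imp_bounded compact_continuous_image) (auto intro: continuous_on_subset)
  then obtain B where B: "\<And>x. norm x \<le> r \<Longrightarrow> norm (f x) \<le> B"
    unfolding bounded_iff by (metis imageI mem_cball_0)
  have C0: "0 \<le> C v" for v using C Ck_bound_nonneg by blast
  define D where "D = (\<Sum>b\<in>Basis. C b)"
  have "norm (f x) \<le> max B D" for x
  proof (cases "norm x \<le> r")
    case False
    then show ?thesis
      using Suc.prems(2)[of x] sum_nonneg[of Basis C] C0 by (auto simp: D_def)
  qed (use B[of x] in auto)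
  moreover have "Ck_bound k (max B D * norm v) (\<lambda>x. f' x v)" for v
  proof -
    have eq: "(\<lambda>x. f' x v) = (\<lambda>x. \<Sum>b\<in>Basis. (v \<bullet> b) *\<^sub>R f' x b)"
    proof
      fix x
      have "linear (f' x)" using f'(1) has_derivative_linear by blast
      then show "f' x v = (\<Sum>b\<in>Basis. (v \<bullet> b) *\<^sub>R f' x b)"
        by (rule linear_Basis_expansion)
    qed
    have "Ck_bound k (\<Sum>b\<in>Basis. \<bar>v \<bullet> b\<bar> * C b) (\<lambda>x. f' x v)"
      unfolding eq by (intro Ck_bound_sum Ck_bound_scaleR_const C)
    moreover have "(\<Sum>b\<in>Basis. \<bar>v \<bullet> b\<bar> * C b) \<le> (\<Sum>b\<in>Basis. norm v * C b)"
      by (intro sum_mono mult_right_mono Basis_le_norm C0)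
    moreover have "(\<Sum>b\<in>Basis. norm v * C b) \<le> max B D * norm v"
      by (metis D_def max.cobounded2 mult.commute mult_right_mono norm_ge_zero sum_distrib_left)
    ultimately show ?thesis using Ck_bound_mono order_trans by blast
  qed
  ultimately show ?case using Ck_bound_SucI[OF f'(1)] by blast
qed

text \<open>The Weierstrass test gives continuity, and uniform convergence of the derivatives allows
  termwise differentiation. The derivatives in direction \<open>v\<close> are majorised by
  \<open>a i * norm v\<close>, again summable, so the induction continues.\<close>

lemma Ck_bound_suminf:
  fixes g :: "nat \<Rightarrow> 'a::euclidean_space \<Rightarrow> 'b::banach"
  assumes "summable a" "\<And>i. Ck_bound k (a i) (g i)"
  shows "Ck_bound k (suminf a) (\<lambda>x. \<Sum>i. g i x)"
  using assms
proof (induction k arbitrary: a g)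
  case (0 a g)
  have "uniform_limit UNIV (\<lambda>n x. \<Sum>i<n. g i x) (\<lambda>x. \<Sum>i. g i x) sequentially"
    by (rule Weierstrass_m_test) (use 0 in auto)
  then have "continuous_on UNIV (\<lambda>x. \<Sum>i. g i x)"
    by (rule uniform_limit_theorem[rotated])
      (use 0 in \<open>auto intro!: always_eventually continuous_on_sum\<close>)
  moreover have "norm (\<Sum>i. g i x) \<le> suminf a" for x
    by (rule norm_suminf_le) (use 0 in auto)
  ultimately show ?case by simp
next
  case (Suc k a g)
  have nb: "norm (\<Sum>i. g i x) \<le> suminf a" for x
    by (rule norm_suminf_le) (use Suc.prems Ck_bound_norm_le in blast)+
  have a0: "0 \<le> a i" for i using Suc.prems(2) Ck_bound_nonneg by blast
  have "\<exists>f'. (\<forall>x. (g i has_derivative f' x) (at x)) \<and>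
      (\<forall>v. Ck_bound k (a i * norm v) (\<lambda>x. f' x v))" for i
    using Ck_bound_SucE[OF Suc.prems(2)] by metis
  then obtain g' where g': "\<And>i x. (g i has_derivative g' i x) (at x)"
    "\<And>i v. Ck_bound k (a i * norm v) (\<lambda>x. g' i x v)" by metis
  have nb': "norm (g' i x v) \<le> a i * norm v" for i x v
    using Ck_bound_norm_le[OF g'(2)] .
  have sg: "summable (\<lambda>i. g i x)" for x
    by (rule summable_comparison_test'[OF Suc.prems(1)]) (use Suc.prems Ck_bound_norm_le in blast)
  have sg': "summable (\<lambda>i. g' i x v)" for x v
    by (rule summable_comparison_test'[OF summable_mult2[OF Suc.prems(1)]]) (use nb' in blast)
  have "\<exists>G. \<forall>x\<in>UNIV. (\<lambda>i. g i x) sums G x \<and> (G has_derivative (\<lambda>v. \<Sum>i. g' i x v)) (at x within UNIV)"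
  proof (rule has_derivative_series[where x=0])
    fix e :: real assume "0 < e"
    have "(\<lambda>n. \<Sum>i<n. a i) \<longlonglongrightarrow> suminf a" using Suc.prems(1) by (rule summable_LIMSEQ)
    then have "\<forall>\<^sub>F n in sequentially. dist (\<Sum>i<n. a i) (suminf a) < e"
      using \<open>0 < e\<close> by (rule tendstoD)
    then show "\<forall>\<^sub>F n in sequentially. \<forall>x\<in>UNIV. \<forall>h.
        norm ((\<Sum>i<n. g' i x h) - (\<Sum>i. g' i x h)) \<le> e * norm h"
    proof (eventually_elim, intro ballI allI)
      fix n x h assume n: "dist (\<Sum>i<n. a i) (suminf a) < e"
      have "(\<Sum>i. g' i x h) - (\<Sum>i<n. g' i x h) = (\<Sum>i. g' (i + n) x h)"
        using suminf_minus_initial_segment[OF sg'] by simp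
      also have "norm \<dots> \<le> (\<Sum>i. a (i + n) * norm h)"
        by (rule norm_suminf_le)
          (use nb' Suc.prems(1) in \<open>auto intro!: summable_mult2 simp: summable_iff_shift\<close>)
      also have "\<dots> = (\<Sum>i. a (i + n)) * norm h"
        using Suc.prems(1) by (intro suminf_mult2[symmetric]) (simp add: summable_iff_shift)
      also have "(\<Sum>i. a (i + n)) = suminf a - (\<Sum>i<n. a i)"
        using suminf_minus_initial_segment[OF Suc.prems(1)] .
      also have "(suminf a - (\<Sum>i<n. a i)) * norm h \<le> e * norm h"
        using n by (intro mult_right_mono) (auto simp: dist_real_def)
      finally show "norm ((\<Sum>i<n. g' i x h) - (\<Sum>i. g' i x h)) \<le> e * norm h"
        by (simp add: norm_minus_commute)
    qed
  next
    show "(\<lambda>i. g i 0) sums (\<Sum>i. g i 0)" using sg by (rule summable_sums)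
  qed (use g' in auto)
  then obtain G where G: "\<And>x. (\<lambda>i. g i x) sums G x"
    "\<And>x. (G has_derivative (\<lambda>v. \<Sum>i. g' i x v)) (at x)" by auto
  have "G = (\<lambda>x. \<Sum>i. g i x)" using G(1) sums_unique by blast
  moreover have "Ck_bound k (suminf a * norm v) (\<lambda>x. \<Sum>i. g' i x v)" for v
    using Suc.IH[OF summable_mult2[OF Suc.prems(1)] g'(2), of v] suminf_mult2[OF Suc.prems(1)]
    by simp
  ultimately show ?case using Ck_bound_SucI[OF G(2)] nb by blast
qed

section \<open>Cutoff functions of finite differentiability\<close>

text \<open>Up to a constant factor, differentiating a truncated power lowers its exponent by one;
  the base case is the continuity of \<open>max 0 t\<close>.\<close>

lemma Ck_on_max_zero_power: "Ck_on k UNIV (\<lambda>t::real. max 0 t ^ Suc k)"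
proof (induction k)
  case 0
  show ?case by (auto intro!: continuous_intros)
next
  case (Suc k)
  have d: "((\<lambda>t::real. max 0 t ^ Suc (Suc k)) has_field_derivative (real (Suc (Suc k)) * max 0 t ^ Suc k)) (at t)" for t
  proof -
    consider "t < 0" | "t = 0" | "t > 0" by linarith
    then show ?thesis
    proof cases
      case 1
      have "((\<lambda>t::real. 0) has_field_derivative 0) (at t)" by simp
      then have "((\<lambda>t::real. max 0 t ^ Suc (Suc k)) has_field_derivative 0) (at t)"
        by (rule has_field_derivative_transform_within_open[where S="{..<0}"]) (use 1 in auto)
      with 1 show ?thesis by simp
    next
      \<comment> \<open>At the kink the difference quotient equals \<open>max 0 h ^ Suc k\<close>,
        which tends to 0 because the exponent is positive.\<close>
      case 2
      have "(\<lambda>h::real. max 0 h ^ Suc k) \<midarrow>0\<rightarrow> max 0 0 ^ Suc k"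
        by (intro tendsto_intros)
      moreover have "max 0 h ^ Suc k = max 0 h ^ Suc (Suc k) / h" if "h \<noteq> 0" for h :: real
        using that by (auto simp: max_def)
      ultimately have "(\<lambda>h::real. max 0 h ^ Suc (Suc k) / h) \<midarrow>0\<rightarrow> 0"
        by (elim LIM_cong[THEN iffD1, rotated -1]) auto
      with 2 show ?thesis by (simp add: DERIV_def)
    next
      case 3
      have "((\<lambda>t::real. t ^ Suc (Suc k)) has_field_derivative real (Suc (Suc k)) * t ^ Suc k) (at t)"
        using DERIV_pow[of "Suc (Suc k)" t] by simp
      then have "((\<lambda>t::real. max 0 t ^ Suc (Suc k)) has_field_derivative real (Suc (Suc k)) * t ^ Suc k) (at t)"
        by (rule has_field_derivative_transform_within_open[where S="{0<..}"]) (use 3 in auto)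
      with 3 show ?thesis by simp
    qed
  qed
  show ?case
  proof (rule Ck_on_SucI[where f'="\<lambda>t h. (real (Suc (Suc k)) * max 0 t ^ Suc k) * h"])
    show "Ck_on k UNIV (\<lambda>x::real. real (Suc (Suc k)) * max 0 x ^ Suc k * v)" for v
      using Ck_on_linear_image[OF open_UNIV bounded_linear_mult_right[of "real (Suc (Suc k)) * v"] Suc.IH]
      by (simp add: mult_ac)
  qed (use d in \<open>auto simp: has_field_derivative_def\<close>)
qed

text \<open>With \<open>w t = max 0 t ^ Suc k\<close> the function is
  \<open>w (1 - w (2 * (x \<bullet> x) - 1))\<close>. Near 0 the inner \<open>w\<close> is 0 and the
  value is \<open>w 1 = 1\<close>; for \<open>1 \<le> norm x\<close> the inner \<open>w\<close> is
  at least 1 and the outer one vanishes. The polynomial \<open>x \<bullet> x\<close> replaces the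
  norm, which is not differentiable at 0.\<close>

lemma Ck_plateau_exists:
  "\<exists>b :: 'a::euclidean_space \<Rightarrow> real. Ck_on k UNIV b \<and>
     (\<forall>x. x \<bullet> x \<le> 1 / 2 \<longrightarrow> b x = 1) \<and> (\<forall>x. 1 \<le> norm x \<longrightarrow> b x = 0)"
proof -
  define w where "w = (\<lambda>t::real. max 0 t ^ Suc k)"
  have w: "Ck_on k UNIV w" unfolding w_def by (rule Ck_on_max_zero_power)
  have inner: "Ck_on k UNIV (\<lambda>x::'a. x \<bullet> x)"
  proof -
    have "Ck_on k UNIV (\<lambda>x::'a. \<Sum>b\<in>Basis. (x \<bullet> b) *\<^sub>R (x \<bullet> b))"
      by (intro Ck_on_sum Ck_on_scaleR open_UNIV Ck_on_bounded_linear bounded_linear_inner_left)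
    then show ?thesis by (simp add: euclidean_inner[of x x for x :: 'a])
  qed
  define b where "b = (\<lambda>x::'a. w (1 + (-1) *\<^sub>R w ((-1) + 2 *\<^sub>R (x \<bullet> x))))"
  have "Ck_on k UNIV (\<lambda>x::'a. (-1) + 2 *\<^sub>R (x \<bullet> x))"
    by (intro Ck_on_add Ck_on_scaleR Ck_on_const inner open_UNIV)
  from Ck_on_compose[OF open_UNIV open_UNIV subset_UNIV this w]
  have "Ck_on k UNIV (\<lambda>x::'a. 1 + (-1) *\<^sub>R w ((-1) + 2 *\<^sub>R (x \<bullet> x)))"
    by (intro Ck_on_add Ck_on_scaleR Ck_on_const open_UNIV)
  from Ck_on_compose[OF open_UNIV open_UNIV subset_UNIV this w]
  have "Ck_on k UNIV b" unfolding b_def .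
  moreover have "b x = 1" if "x \<bullet> x \<le> 1 / 2" for x
    using that by (simp add: b_def w_def)
  moreover have "b x = 0" if "1 \<le> norm x" for x
  proof -
    have "1 \<le> x \<bullet> x" using that by (simp add: dot_square_norm)
    then have "1 \<le> w (2 * (x \<bullet> x) - 1)"
      unfolding w_def by (intro one_le_power) auto
    then show ?thesis by (simp add: b_def w_def)
  qed
  ultimately show ?thesis by blast
qed

section \<open>Bump functions on cylinders\<close>

text \<open>The image stays in the ambient space, so that \<open>I\<close> can be a set obtained
  inside a proof rather than part of a type.\<close>

definition coord_proj :: "'n set \<Rightarrow> real^'n \<Rightarrow> real^'n" where
  "coord_proj I y = (\<chi> i. if i \<in> I then y $ i else 0)"

lemma coord_proj_nth [simp]: "coord_proj I y $ i = (if i \<in> I then y $ i else 0)"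
  by (simp add: coord_proj_def)

lemma coord_proj_diff: "coord_proj I (x - y) = coord_proj I x - coord_proj I y"
  by (simp add: vec_eq_iff)

lemma bounded_linear_coord_proj: "bounded_linear (coord_proj I)"
  by (intro linear_conv_bounded_linear[THEN iffD1] linearI) (auto simp: vec_eq_iff)

lemma norm_coord_proj_le: "norm (coord_proj I y) \<le> norm y"
  unfolding norm_vec_def by (rule L2_set_mono) auto

text \<open>A bump of radius \<open>r\<close> around \<open>x\<close> in the coordinates
  \<open>I\<close>, constant in the other coordinates, as a shear requires.\<close>

definition cylinder_bump :: "(real^'n \<Rightarrow> real) \<Rightarrow> 'n set \<Rightarrow> real^'n \<Rightarrow> real \<Rightarrow> real^'n \<Rightarrow> real" where
  "cylinder_bump b I x r y = b ((1 / r) *\<^sub>R coord_proj I (y - x))"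

lemma cylinder_bump_cong:
  assumes "\<And>i. i \<in> I \<Longrightarrow> y $ i = y' $ i"
  shows "cylinder_bump b I x r y = cylinder_bump b I x r y'"
proof -
  have "coord_proj I (y - x) = coord_proj I (y' - x)" using assms by (auto simp: vec_eq_iff)
  then show ?thesis by (simp add: cylinder_bump_def)
qed

lemma cylinder_bump_eq_0:
  assumes "\<And>x. 1 \<le> norm x \<Longrightarrow> b x = 0" "0 < r" "i \<in> I" "r \<le> \<bar>y $ i - x $ i\<bar>"
  shows "cylinder_bump b I x r y = 0"
proof -
  have "1 \<le> \<bar>((1 / r) *\<^sub>R coord_proj I (y - x)) $ i\<bar>" using assms by (simp add: abs_mult)
  then show ?thesis
    unfolding cylinder_bump_def using component_le_norm_cart order_trans by (intro assms(1)) blast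
qed

text \<open>The Euclidean norm is at most the sum of the absolute coordinates, so after rescaling
  the argument of \<open>b\<close> has norm at most 1/2 and lies on the plateau.\<close>

lemma cylinder_bump_eq_1:
  fixes b :: "real^'n \<Rightarrow> real"
  assumes "\<And>x. x \<bullet> x \<le> 1 / 2 \<Longrightarrow> b x = 1" "0 < r"
    and "\<And>i. i \<in> I \<Longrightarrow> \<bar>y $ i - x $ i\<bar> \<le> r / (2 * real CARD('n))"
  shows "cylinder_bump b I x r y = 1"
proof -
  define v where "v = (1 / r) *\<^sub>R coord_proj I (y - x)"
  have comp: "\<bar>v $ i\<bar> \<le> 1 / (2 * real CARD('n))" for i
    using assms(2) assms(3)[of i] by (auto simp: v_def abs_mult field_simps)
  have "norm v \<le> (\<Sum>i\<in>UNIV. \<bar>v $ i\<bar>)" by (rule norm_le_l1_cart)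
  also have "\<dots> \<le> (\<Sum>i\<in>(UNIV::'n set). 1 / (2 * real CARD('n)))" by (rule sum_mono) (rule comp)
  finally have "norm v \<le> 1 / 2" by simp
  then have "(norm v)\<^sup>2 \<le> (1 / 2)\<^sup>2" by (intro power_mono) auto
  then have "v \<bullet> v \<le> 1 / 2" by (simp add: dot_square_norm power2_eq_square)
  then show ?thesis unfolding cylinder_bump_def using assms(1) v_def by blast
qed

lemma Ck_bound_cylinder:
  fixes b :: "real^'n \<Rightarrow> 'b::real_normed_vector"
  assumes "Ck_bound k C b" "0 < r" "1 \<le> L" "1 / r \<le> L"
  shows "Ck_bound k (C * L ^ k) (\<lambda>y. b ((1 / r) *\<^sub>R coord_proj I (y - x)))"
proof -
  have "norm ((1 / r) *\<^sub>R coord_proj I v) \<le> L * norm v" for v :: "real^'n"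
  proof -
    have "(1 / r) * norm (coord_proj I v) \<le> L * norm v"
      using assms by (intro mult_mono norm_coord_proj_le) auto
    then show ?thesis using assms by simp
  qed
  from Ck_bound_compose_affine[OF bounded_linear_const_scaleR[OF bounded_linear_coord_proj] this assms(3,1),
      of "- ((1 / r) *\<^sub>R coord_proj I x)"]
  show ?thesis
    by (simp add: coord_proj_diff scaleR_diff_right)
qed

lemma Ck_bound_cylinder_bump:
  assumes "Ck_bound k C b" "0 < r" "r \<le> 1"
  shows "Ck_bound k (C / r ^ k) (cylinder_bump b I x r)"
  using Ck_bound_cylinder[OF assms(1,2), of "1 / r" I x] assms(2,3)
  unfolding cylinder_bump_def[abs_def] by (simp add: power_one_over divide_inverse one_le_inverse power_inverse)

text \<open>The coordinate \<open>y $ i\<close> is unbounded. In terms of the rescaled projection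
  \<open>z\<close> of \<open>y - x\<close>, however, the product is
  \<open>r * (b z * z $ i) + x $ i * b z\<close>, a combination of compactly supported functions of
  \<open>z\<close>.\<close>

lemma Ck_bound_cylinder_bump_mult_coord:
  fixes b :: "real^'n \<Rightarrow> real"
  assumes b: "Ck_on k UNIV b" "\<And>x. 1 \<le> norm x \<Longrightarrow> b x = 0" and r: "0 < r"
  obtains D where "Ck_bound k D (cylinder_bump b I x r)"
    "\<And>i. i \<in> I \<Longrightarrow> Ck_bound k D (\<lambda>y. cylinder_bump b I x r y * y $ i)"
proof -
  define L where "L = max 1 (1 / r)"
  have L: "1 \<le> L" "1 / r \<le> L" by (auto simp: L_def)
  obtain C where C: "Ck_bound k C b"
    using Ck_bound_compact_support[of k b 1] b by force
  have cb: "Ck_bound k (C * L ^ k) (cylinder_bump b I x r)"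
    using Ck_bound_cylinder[OF C r L] unfolding cylinder_bump_def[abs_def] .
  have "\<exists>C. Ck_bound k C (\<lambda>z. b z * z $ i)" for i
  proof (rule Ck_bound_compact_support)
    have "Ck_on k UNIV (\<lambda>z. b z *\<^sub>R (z $ i))"
      by (intro Ck_on_scaleR b open_UNIV Ck_on_bounded_linear bounded_linear_vec_nth)
    then show "Ck_on k UNIV (\<lambda>z. b z * z $ i)" by simp
    show "b z * z $ i = 0" if "1 < norm z" for z using b(2)[of z] that by simp
  qed
  then obtain Ci where Ci: "\<And>i. Ck_bound k (Ci i) (\<lambda>z. b z * z $ i)" by metis
  define Di where "Di = (\<lambda>i. \<bar>r\<bar> * (Ci i * L ^ k) + \<bar>x $ i\<bar> * (C * L ^ k))"
  have Di: "Ck_bound k (Di i) (\<lambda>y. cylinder_bump b I x r y * y $ i)" if "i \<in> I" for i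
  proof -
    have "Ck_bound k (Di i) (\<lambda>y. r *\<^sub>R (b ((1 / r) *\<^sub>R coord_proj I (y - x)) * ((1 / r) *\<^sub>R coord_proj I (y - x)) $ i)
        + (x $ i) *\<^sub>R cylinder_bump b I x r y)"
      unfolding Di_def
      by (intro Ck_bound_add Ck_bound_scaleR_const cb Ck_bound_cylinder[OF Ci r L])
    moreover have "r *\<^sub>R (b ((1 / r) *\<^sub>R coord_proj I (y - x)) * ((1 / r) *\<^sub>R coord_proj I (y - x)) $ i)
        + (x $ i) *\<^sub>R cylinder_bump b I x r y = cylinder_bump b I x r y * y $ i" for y
      using that r by (simp add: cylinder_bump_def algebra_simps)
    ultimately show ?thesis by simp
  qed
  have pos: "0 \<le> Di i" if "i \<in> I" for i using Ck_bound_nonneg[OF Di[OF that]] .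
  show ?thesis
  proof (rule that[of "C * L ^ k + (\<Sum>i\<in>I. Di i)"])
    show "Ck_bound k (C * L ^ k + (\<Sum>i\<in>I. Di i)) (cylinder_bump b I x r)"
      by (rule Ck_bound_mono[OF cb]) (use pos in \<open>auto intro: sum_nonneg\<close>)
    show "Ck_bound k (C * L ^ k + (\<Sum>i\<in>I. Di i)) (\<lambda>y. cylinder_bump b I x r y * y $ i)" if i: "i \<in> I" for i
    proof (rule Ck_bound_mono[OF Di[OF i]])
      have "Di i \<le> (\<Sum>i\<in>I. Di i)" using i pos by (intro member_le_sum) auto
      then show "Di i \<le> C * L ^ k + (\<Sum>i\<in>I. Di i)" using Ck_bound_nonneg[OF cb] by linarith
    qed
  qed
qed

text \<open>An affine map from the coordinates \<open>I\<close> to the remaining ones, multiplied by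
  the cutoff \<beta>. The cutoff is distributed over the terms because the available bounds concern
  \<open>\<beta> y\<close> and \<open>\<beta> y * y $ i\<close>.\<close>

definition affine_cutoff :: "(real^'n \<Rightarrow> real) \<Rightarrow> 'n set \<Rightarrow> ('n \<Rightarrow> 'n \<Rightarrow> real) \<Rightarrow> ('n \<Rightarrow> real) \<Rightarrow> real^'n \<Rightarrow> real^'n" where
  "affine_cutoff \<beta> I A t y = (\<Sum>j\<in>-I. ((\<Sum>i\<in>I. A j i * (\<beta> y * y $ i)) + t j * \<beta> y) *\<^sub>R axis j 1)"

lemma affine_cutoff_nth:
  "affine_cutoff \<beta> I A t y $ j = (if j \<in> I then 0 else \<beta> y * ((\<Sum>i\<in>I. A j i * y $ i) + t j))"
proof -
  have "affine_cutoff \<beta> I A t y $ j =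
      (\<Sum>l\<in>-I. if l = j then (\<Sum>i\<in>I. A l i * (\<beta> y * y $ i)) + t l * \<beta> y else 0)"
    unfolding affine_cutoff_def sum_component by (rule sum.cong) (auto simp: axis_def)
  also have "\<dots> = (if j \<in> I then 0 else (\<Sum>i\<in>I. A j i * (\<beta> y * y $ i)) + t j * \<beta> y)"
    by (auto simp: sum.delta)
  finally show ?thesis by (simp add: distrib_left sum_distrib_left mult_ac)
qed

lemma Ck_bound_affine_cutoff:
  fixes \<beta> :: "real^'n \<Rightarrow> real"
  assumes D: "Ck_bound k D \<beta>" "\<And>i. i \<in> I \<Longrightarrow> Ck_bound k D (\<lambda>y. \<beta> y * y $ i)"
    and A: "\<And>j i. \<bar>A j i\<bar> \<le> \<eta>" "\<And>j. \<bar>t j\<bar> \<le> \<eta>"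
    and \<delta>: "real CARD('n) * ((real CARD('n) + 1) * (\<eta> * D)) \<le> \<delta>"
  shows "Ck_bound k \<delta> (affine_cutoff \<beta> I A t)"
proof -
  have D0: "0 \<le> D" using Ck_bound_nonneg[OF D(1)] .
  have \<eta>0: "0 \<le> \<eta>" using A(2)[of undefined] by linarith
  have inner: "Ck_bound k ((real CARD('n) + 1) * (\<eta> * D)) (\<lambda>y. (\<Sum>i\<in>I. A j i * (\<beta> y * y $ i)) + t j * \<beta> y)" for j
  proof -
    have 1: "Ck_bound k (\<bar>A j i\<bar> * D) (\<lambda>y. A j i * (\<beta> y * y $ i))" if "i \<in> I" for i
      using Ck_bound_scaleR_const[OF D(2)[OF that], of "A j i"] by simp
    have 2: "Ck_bound k (\<bar>t j\<bar> * D) (\<lambda>y. t j * \<beta> y)"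
      using Ck_bound_scaleR_const[OF D(1), of "t j"] by simp
    have "(\<Sum>i\<in>I. \<bar>A j i\<bar> * D) \<le> (\<Sum>i\<in>I. \<eta> * D)"
      by (intro sum_mono mult_right_mono A D0)
    also have "\<dots> \<le> (\<Sum>i\<in>(UNIV::'n set). \<eta> * D)"
      using \<eta>0 D0 by (intro sum_mono2) auto
    finally have "(\<Sum>i\<in>I. \<bar>A j i\<bar> * D) \<le> real CARD('n) * (\<eta> * D)" by simp
    moreover have "\<bar>t j\<bar> * D \<le> \<eta> * D" by (intro mult_right_mono A D0)
    ultimately have "(\<Sum>i\<in>I. \<bar>A j i\<bar> * D) + \<bar>t j\<bar> * D \<le> (real CARD('n) + 1) * (\<eta> * D)"
      by (simp add: algebra_simps)
    moreover have "Ck_bound k (\<Sum>i\<in>I. \<bar>A j i\<bar> * D) (\<lambda>y. \<Sum>i\<in>I. A j i * (\<beta> y * y $ i))"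
      by (intro Ck_bound_sum 1)
    ultimately show ?thesis using Ck_bound_mono[OF Ck_bound_add[OF _ 2]] by blast
  qed
  have "Ck_bound k (\<Sum>j\<in>-I. norm (axis j 1 :: real^'n) * ((real CARD('n) + 1) * (\<eta> * D)))
      (\<lambda>y. affine_cutoff \<beta> I A t y)"
    unfolding affine_cutoff_def by (intro Ck_bound_sum Ck_bound_scaleR_vector inner)
  moreover have "(\<Sum>j\<in>-I. norm (axis j 1 :: real^'n) * ((real CARD('n) + 1) * (\<eta> * D)))
      \<le> (\<Sum>j\<in>(UNIV::'n set). (real CARD('n) + 1) * (\<eta> * D))"
    using \<eta>0 D0 by (auto simp: norm_axis_1 simp del: sum_constant intro!: sum_mono2)
  then have "(\<Sum>j\<in>-I. norm (axis j 1 :: real^'n) * ((real CARD('n) + 1) * (\<eta> * D))) \<le> \<delta>"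
    using \<delta> unfolding sum_constant by linarith
  ultimately show ?thesis by (rule Ck_bound_mono)
qed

text \<open>A bump of height \<open>h\<close> and radius \<open>r\<close> costs
  \<open>h * (C / r ^ k)\<close>. Centres more than \<open>2 * r\<close> apart in some coordinate of
  \<open>I\<close> make the supports disjoint, so the whole sum costs no more than one bump.\<close>

lemma Ck_bound_separated_bumps:
  fixes b :: "real^'n \<Rightarrow> real" and v :: "real^'n \<Rightarrow> real^'n"
  assumes b: "Ck_bound k C b" "\<And>x. 1 \<le> norm x \<Longrightarrow> b x = 0" and r: "0 < r" "r \<le> 1" and X: "finite X"
    and v: "\<And>x. x \<in> X \<Longrightarrow> norm (v x) \<le> h" "0 \<le> h"
    and sep: "\<And>x y. x \<in> X \<Longrightarrow> y \<in> X \<Longrightarrow> x \<noteq> y \<Longrightarrow> \<exists>i\<in>I. 2 * r < \<bar>x $ i - y $ i\<bar>"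
    and \<delta>: "h * (C / r ^ k) \<le> \<delta>"
  shows "Ck_bound k \<delta> (\<lambda>y. \<Sum>x\<in>X. cylinder_bump b I x r y *\<^sub>R v x)"
proof (rule Ck_bound_disjoint_sum[OF X])
  have C0: "0 \<le> C" using Ck_bound_nonneg[OF b(1)] .
  show "0 \<le> \<delta>" using order_trans[OF _ \<delta>] v(2) C0 r by simp
  show "Ck_bound k \<delta> (\<lambda>y. cylinder_bump b I x r y *\<^sub>R v x)" if "x \<in> X" for x
  proof (rule Ck_bound_mono[OF Ck_bound_scaleR_vector[OF Ck_bound_cylinder_bump[OF b(1) r]]])
    show "norm (v x) * (C / r ^ k) \<le> \<delta>"
      using mult_right_mono[OF v(1)[OF that], of "C / r ^ k"] C0 r \<delta> by simp
  qed
  fix y :: "real^'n"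
  have vanish: "\<exists>T. open T \<and> y \<in> T \<and> (\<forall>y'\<in>T. cylinder_bump b I x r y' *\<^sub>R v x = 0)"
    if "i \<in> I" "r < \<bar>y $ i - x $ i\<bar>" for x i
  proof (intro exI[of _ "{y'. r < \<bar>y' $ i - x $ i\<bar>}"] conjI ballI)
    show "open {y'. r < \<bar>y' $ i - x $ i\<bar>}" by (intro open_Collect_less continuous_intros)
    show "cylinder_bump b I x r y' *\<^sub>R v x = 0" if "y' \<in> {y'. r < \<bar>y' $ i - x $ i\<bar>}" for y'
      using cylinder_bump_eq_0[OF b(2) r(1) \<open>i \<in> I\<close>, where y=y' and x=x] that by simp
  qed (use that in auto)
  \<comment> \<open>If \<open>y\<close> is within \<open>r\<close> of a centre in every coordinate
    of \<open>I\<close>, separation puts it farther than \<open>r\<close> from every other centre.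
    Otherwise all the bumps vanish near \<open>y\<close>.\<close>
  show "\<exists>x. \<forall>x'\<in>X - {x}. \<exists>T. open T \<and> y \<in> T \<and> (\<forall>y'\<in>T. cylinder_bump b I x' r y' *\<^sub>R v x' = 0)"
  proof (cases "\<exists>x\<in>X. \<forall>i\<in>I. \<bar>y $ i - x $ i\<bar> \<le> r")
    case True
    then obtain x where x: "x \<in> X" "\<And>i. i \<in> I \<Longrightarrow> \<bar>y $ i - x $ i\<bar> \<le> r" by blast
    have "\<exists>T. open T \<and> y \<in> T \<and> (\<forall>y'\<in>T. cylinder_bump b I x' r y' *\<^sub>R v x' = 0)" if x': "x' \<in> X - {x}" for x'
    proof -
      obtain i where i: "i \<in> I" "2 * r < \<bar>x $ i - x' $ i\<bar>" using sep[of x x'] x(1) x' by blast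
      have "r < \<bar>y $ i - x' $ i\<bar>" using i x(2)[OF i(1)] by linarith
      then show ?thesis using vanish i(1) by blast
    qed
    then show ?thesis by blast
  next
    case False
    then show ?thesis using vanish by (metis DiffD1 not_le)
  qed
qed

section \<open>Coordinate projections of submanifolds\<close>

text \<open>The projection is open at \<open>p\<close> because the parametrisation of \<open>\<Sigma>\<close>, completed by the
  coordinate directions in \<open>J\<close>, has surjective derivative there.\<close>

lemma Ck_submanifold_projection_contains_box:
  fixes \<Sigma> :: "(real^'n) set"
  assumes mfd: "Ck_submanifold k m \<Sigma>" and "1 \<le> k" "\<Sigma> \<noteq> {}"
  obtains I a \<rho> where "card I = m" "0 < \<rho>"
    "\<forall>y. (\<forall>i\<in>I. \<bar>y $ i - a $ i\<bar> < \<rho>) \<longrightarrow> (\<exists>\<sigma>\<in>\<Sigma>. \<forall>i\<in>I. \<sigma> $ i = y $ i)"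
proof -
  obtain p where p: "p \<in> \<Sigma>" using assms(3) by blast
  obtain U V \<phi> L where U: "p \<in> U" and diffeo: "Ck_diffeo k U V \<phi>" and L: "subspace L" "dim L = m"
    and im: "\<phi> ` (U \<inter> \<Sigma>) = V \<inter> L"
    using mfd p unfolding Ck_submanifold_def by blast
  define \<Psi> where "\<Psi> = inv_into U \<phi>"
  define v0 where "v0 = \<phi> p"
  obtain k' where k': "k = Suc k'" using assms(2) by (cases k) auto
  have opn: "open U" "open V" and bij: "bij_betw \<phi> U V" and
    d\<phi>: "\<phi> differentiable_on U" and d\<Psi>: "\<Psi> differentiable_on V"
    using diffeo unfolding Ck_diffeo_def k' \<Psi>_def by auto
  have v0: "v0 \<in> V" "v0 \<in> L" using im p U unfolding v0_def by blast+
  have \<Psi>v0: "\<Psi> v0 = p" unfolding \<Psi>_def v0_def using bij U by (simp add: bij_betw_inv_into_left)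
  have \<phi>\<Psi>: "\<phi> (\<Psi> v) = v" if "v \<in> V" for v
    unfolding \<Psi>_def using bij that by (simp add: bij_betw_inv_into_right)
  have \<Psi>mem: "\<Psi> v \<in> \<Sigma>" if "v \<in> V" "v \<in> L" for v
  proof -
    have "v \<in> \<phi> ` (U \<inter> \<Sigma>)" using im that by simp
    then obtain x where x: "x \<in> U" "x \<in> \<Sigma>" "v = \<phi> x" by blast
    then have "\<Psi> v = x" unfolding \<Psi>_def using bij_betw_inv_into_left[OF bij x(1)] by simp
    with x show ?thesis by simp
  qed
  obtain D where D: "(\<Psi> has_derivative D) (at v0)"
    using d\<Psi> opn v0 by (auto simp: differentiable_on_eq_differentiable_at differentiable_def)
  obtain D' where D': "(\<phi> has_derivative D') (at (\<Psi> v0))"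
    using d\<phi> opn U \<Psi>v0 by (auto simp: differentiable_on_eq_differentiable_at differentiable_def)
  have linD: "linear D" using D has_derivative_linear by blast
  have "((\<lambda>v. \<phi> (\<Psi> v)) has_derivative (\<lambda>h. D' (D h))) (at v0)"
    using has_derivative_compose[OF D D'] .
  moreover have "((\<lambda>v. \<phi> (\<Psi> v)) has_derivative (\<lambda>h. h)) (at v0)"
    by (rule has_derivative_transform_within_open[OF has_derivative_ident opn(2) v0(1)])
      (use \<phi>\<Psi> in auto)
  \<comment> \<open>The chart provides a left inverse of \<open>D\<close>, so \<open>D\<close> is
    injective and the tangent space \<open>W\<close> has dimension \<open>m\<close>.\<close>
  ultimately have "(\<lambda>h. D' (D h)) = (\<lambda>h. h)" by (rule has_derivative_unique)
  then have injD: "inj D" by (metis injI)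
  define W where "W = D ` L"
  have dimW: "dim W = m"
    unfolding W_def using dim_image_eq[OF linD] injD L by (metis inj_on_subset subset_UNIV)
  have subW: "subspace W" unfolding W_def using linD L(1) by (rule linear_subspace_image)
  obtain BW where BW: "BW \<subseteq> W" "independent BW" "W \<subseteq> span BW" "card BW = dim W"
    using basis_exists by blast
  \<comment> \<open>Steinitz exchange: a basis of the tangent space is completed to a basis of the
    whole space by coordinate vectors. Their indices will form \<open>J\<close>, and the other
    \<open>m\<close> indices \<open>I\<close>.\<close>
  obtain B' where B': "BW \<subseteq> B'" "B' \<subseteq> BW \<union> Basis" "independent B'" "BW \<union> Basis \<subseteq> span B'"
    using maximal_independent_subset_extend[of BW "BW \<union> Basis"] BW(2) by blast
  have spanB': "span B' = UNIV"
    using B'(4) by (metis Un_subset_iff span_Basis span_mono span_span top.extremum_uniqueI)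
  have cardB': "card B' = CARD('n)"
    using dim_eq_card[OF _ B'(3), of UNIV] spanB' by simp
  define Jset where "Jset = B' - BW"
  define J where "J = {j::'n. axis j 1 \<in> Jset}"
  define I where "I = - J"
  have JB: "Jset \<subseteq> Basis" using B'(2) by (auto simp: Jset_def)
  have Jim: "Jset = (\<lambda>j. axis j 1) ` J"
    using JB by (auto simp: J_def Basis_vec_def image_iff)
  have "card Jset = card J"
    unfolding Jim by (rule card_image) (auto simp: inj_on_def axis_eq_axis)
  moreover have "finite B'" using B'(3) independent_imp_finite by blast
  then have "card Jset = CARD('n) - m"
    unfolding Jset_def using B'(1) cardB' BW(4) dimW by (metis card_Diff_subset finite_subset)
  moreover have "m \<le> CARD('n)" using dimW dim_subset_UNIV[of W] by simp
  ultimately have cardI: "card I = m"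
    unfolding I_def by (simp add: Compl_eq_Diff_UNIV card_Diff_subset)
  define R where "R = (coord_proj J :: real^'n \<Rightarrow> real^'n)"
  have linR: "linear R"
    unfolding R_def using bounded_linear_coord_proj by (rule bounded_linear.linear)
  have Rspan: "R j = j" if "j \<in> span Jset" for j
    by (rule linear_eq_on_span[OF linR linear_ident _ that])
      (auto simp: Jim R_def vec_eq_iff axis_def)
  \<comment> \<open>A linear projection onto \<open>L\<close>, which lets the parametrisation of
    \<Sigma> be written on the full space instead of on a space of dimension
    \<open>m\<close>.\<close>
  obtain P where P: "range P \<subseteq> L" "linear P" "\<And>v. v \<in> L \<Longrightarrow> P v = v"
    using linear_exists_left_inverse_on[OF linear_ident L(1)] by auto
  \<comment> \<open>A point of \<Sigma> plus a displacement in the coordinates \<open>J\<close>. The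
    displacement does not affect the coordinates in \<open>I\<close>, so openness of
    \<open>F\<close> at the base point gives openness of the projection of \<Sigma>.\<close>
  define F where "F = (\<lambda>x::(real^'n) \<times> (real^'n). \<Psi> (P (fst x)) + R (snd x))"
  define F' where "F' = (\<lambda>x::(real^'n) \<times> (real^'n). D (P (fst x)) + R (snd x))"
  have blP: "bounded_linear (\<lambda>x::(real^'n) \<times> (real^'n). P (fst x))"
    using P(2) by (intro bounded_linear_compose[OF _ bounded_linear_fst]) (simp add: linear_conv_bounded_linear)
  have blR: "bounded_linear (\<lambda>x::(real^'n) \<times> (real^'n). R (snd x))"
    using linR by (intro bounded_linear_compose[OF _ bounded_linear_snd]) (simp add: linear_conv_bounded_linear)
  have derF: "(F has_derivative F') (at (v0, 0))"
  proof -
    have "((\<lambda>x::(real^'n) \<times> (real^'n). P (fst x)) has_derivative (\<lambda>x. P (fst x))) (at (v0, 0))"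
      using blP by (rule bounded_linear_imp_has_derivative)
    moreover have "(\<Psi> has_derivative D) (at (P (fst (v0, 0::real^'n))))" using D P(3) v0 by simp
    ultimately have "((\<lambda>x. \<Psi> (P (fst x))) has_derivative (\<lambda>x. D (P (fst x)))) (at (v0, 0::real^'n))"
      by (rule has_derivative_compose)
    then show ?thesis unfolding F_def F'_def
      by (intro has_derivative_add bounded_linear_imp_has_derivative[OF blR])
  qed
  have "surj F'"
  proof (rule surjI)
    fix y :: "real^'n"
    have "y \<in> span (BW \<union> Jset)" using spanB' B'(1) by (simp add: Jset_def Un_absorb1)
    then obtain w j where wj: "w \<in> span BW" "j \<in> span Jset" "y = w + j"
      by (auto simp: span_Un)
    have "span BW \<subseteq> W" using BW(1) subW by (rule span_minimal)
    then obtain l where l: "l \<in> L" "w = D l" using wj(1) unfolding W_def by blast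
    have "F' (l, j) = y" using l wj Rspan P(3) by (simp add: F'_def)
    then show "F' (SOME x. F' x = y) = y" by (rule someI)
  qed
  then obtain G' where G': "linear G'" "F' \<circ> G' = id"
    using linear_surjective_right_inverse has_derivative_linear[OF derF] by blast
  define S where "S = (\<lambda>x::(real^'n) \<times> (real^'n). P (fst x)) -` V"
  have opS: "open S"
    unfolding S_def using opn(2) blP by (intro open_vimage) (auto intro: linear_continuous_on)
  have xS: "(v0, 0) \<in> S" using P(3) v0 by (simp add: S_def)
  have "F (v0, 0) \<in> interior (F ` S)"
  \<comment> \<open>This open mapping theorem asks for continuity on \<open>S\<close> and for a
    surjective derivative at the one point only.\<close>
  proof (rule sussmann_open_mapping[OF opS _ xS derF _ G'(2) subset_refl])
    have "continuous_on S (\<lambda>x. \<Psi> (P (fst x)))"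
      by (rule continuous_on_compose2[OF differentiable_imp_continuous_on[OF d\<Psi>] linear_continuous_on[OF blP]])
        (auto simp: S_def)
    then show "continuous_on S F"
      unfolding F_def by (intro continuous_on_add linear_continuous_on[OF blR])
    show "(v0, 0) \<in> interior S" using xS opS by (simp add: interior_open)
  qed (use G'(1) in \<open>simp add: linear_conv_bounded_linear\<close>)
  moreover have "F (v0, 0) = p" using P(3) v0 \<Psi>v0 linear_0[OF linR] by (simp add: F_def)
  ultimately obtain e where e: "0 < e" "ball p e \<subseteq> F ` S"
    by (metis mem_interior)
  show ?thesis
  proof (rule that[OF cardI, of "e / CARD('n)" p])
    show "0 < e / CARD('n)" using e by simp
    show "\<forall>y. (\<forall>i\<in>I. \<bar>y $ i - p $ i\<bar> < e / CARD('n)) \<longrightarrow> (\<exists>\<sigma>\<in>\<Sigma>. \<forall>i\<in>I. \<sigma> $ i = y $ i)"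
    proof (intro allI impI)
      fix y :: "real^'n" assume y: "\<forall>i\<in>I. \<bar>y $ i - p $ i\<bar> < e / CARD('n)"
      \<comment> \<open>The coordinates outside \<open>I\<close> are those of \<open>p\<close>, so
        that closeness in \<open>I\<close> alone puts \<open>y'\<close> into the ball.\<close>
      define y' where "y' = (\<chi> i. if i \<in> I then y $ i else p $ i)"
      have "norm (y' - p) \<le> (\<Sum>i\<in>UNIV. \<bar>(y' - p) $ i\<bar>)" by (rule norm_le_l1_cart)
      also have "\<dots> < (\<Sum>i\<in>(UNIV::'n set). e / CARD('n))"
        by (rule sum_strict_mono) (use y e in \<open>auto simp: y'_def\<close>)
      finally have "y' \<in> ball p e" by (simp add: dist_norm norm_minus_commute)
      then obtain x where x: "x \<in> S" "y' = F x" using e by blast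
      have "\<Psi> (P (fst x)) \<in> \<Sigma>" using x(1) P(1) by (intro \<Psi>mem) (auto simp: S_def)
      moreover have "\<Psi> (P (fst x)) $ i = y $ i" if "i \<in> I" for i
      proof -
        have "y' $ i = \<Psi> (P (fst x)) $ i" using that by (simp add: x(2) F_def R_def I_def)
        then show ?thesis using that by (simp add: y'_def)
      qed
      ultimately show "\<exists>\<sigma>\<in>\<Sigma>. \<forall>i\<in>I. \<sigma> $ i = y $ i" by blast
    qed
  qed
qed

section \<open>Random affine maps modulo a prime\<close>

text \<open>Bonferroni inequality. Adding a set to a family of \<open>u\<close> sets loses at most
  \<open>u * b\<close> to overlaps, and \<open>u^2 / 2 + u \<le> (u + 1)^2 / 2\<close>.\<close>

lemma card_Union_pairwise_lower_bound:
  fixes H :: "'u \<Rightarrow> 'q set"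
  assumes "finite U" "\<And>u. u \<in> U \<Longrightarrow> finite (H u)" "\<And>u. u \<in> U \<Longrightarrow> real (card (H u)) = a"
    and "\<And>u u'. u \<in> U \<Longrightarrow> u' \<in> U \<Longrightarrow> u \<noteq> u' \<Longrightarrow> real (card (H u \<inter> H u')) \<le> b" and "0 \<le> b"
  shows "real (card U) * a - (real (card U))\<^sup>2 * b / 2 \<le> real (card (\<Union>u\<in>U. H u))"
  using assms(1-4)
proof (induction U rule: finite_induct)
  case empty
  then show ?case by simp
next
  case (insert x U)
  define A where "A = (\<Union>u\<in>U. H u)"
  have fin: "finite A" "finite (H x)" using insert by (auto simp: A_def)
  have "real (card (A \<inter> H x)) = real (card (\<Union>u\<in>U. H u \<inter> H x))"
    by (simp add: A_def)
  also have "\<dots> \<le> real (\<Sum>u\<in>U. card (H u \<inter> H x))"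
    using card_UN_le[OF insert(1)] of_nat_mono by blast
  also have "\<dots> \<le> (\<Sum>u\<in>U. b)"
    unfolding of_nat_sum by (rule sum_mono) (use insert in auto)
  finally have AH: "real (card (A \<inter> H x)) \<le> real (card U) * b" by simp
  have "real (card (A \<union> H x)) + real (card (A \<inter> H x)) = real (card A) + real (card (H x))"
    using card_Un_Int[OF fin] by simp
  moreover have "real (card U) * a - (real (card U))\<^sup>2 * b / 2 \<le> real (card A)"
    using insert unfolding A_def by auto
  moreover have "real (card (H x)) = a" using insert by auto
  ultimately have "real (card U) * a - (real (card U))\<^sup>2 * b / 2 + a - real (card U) * b
      \<le> real (card (A \<union> H x))"
    using AH by linarith
  moreover have "card (insert x U) = card U + 1" using insert by simp
  moreover have "(\<Union>u\<in>insert x U. H u) = A \<union> H x" by (auto simp: A_def)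
  ultimately show ?case
    using \<open>0 \<le> b\<close> by (simp add: algebra_simps power2_eq_square add_divide_distrib)
qed

text \<open>Translation by \<open>z\<close> permutes the residues modulo \<open>P\<close>.\<close>

lemma card_mod_less:
  fixes z :: int
  assumes "g \<le> P"
  shows "card {t \<in> {0..<int P}. (z + t) mod int P < int g} = g"
proof -
  have "bij_betw (\<lambda>t. (z + t) mod int P) {t \<in> {0..<int P}. (z + t) mod int P < int g} {0..<int g}"
  proof (rule bij_betw_byWitness[where f'="\<lambda>t. (t - z) mod int P"])
    show "\<forall>t\<in>{t \<in> {0..<int P}. (z + t) mod int P < int g}. ((z + t) mod int P - z) mod int P = t"
      by (auto simp: mod_diff_left_eq)
    show "\<forall>t\<in>{0..<int g}. (z + (t - z) mod int P) mod int P = t"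
      using assms by (auto simp: mod_add_right_eq)
    show "(\<lambda>t. (t - z) mod int P) ` {0..<int g} \<subseteq> {t \<in> {0..<int P}. (z + t) mod int P < int g}"
      using assms by (auto simp: mod_add_right_eq)
  qed (use assms in auto)
  from bij_betw_same_card[OF this] show ?thesis by simp
qed

text \<open>Whatever the linear coefficients are, the translation \<open>snd x\<close> alone makes
  the residue uniform, so the event has probability \<open>g / P\<close>.\<close>

lemma card_affine_mod_less:
  assumes "finite I" "g \<le> P"
  shows "card {x \<in> PiE I (\<lambda>_. {0..<int P}) \<times> {0..<int P}.
    (F + (\<Sum>i\<in>I. fst x i * w i) + snd x) mod int P < int g} = P ^ card I * g"
proof -
  have "{x \<in> PiE I (\<lambda>_. {0..<int P}) \<times> {0..<int P}.
      (F + (\<Sum>i\<in>I. fst x i * w i) + snd x) mod int P < int g} =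
    (SIGMA B:PiE I (\<lambda>_. {0..<int P}). {t \<in> {0..<int P}. (F + (\<Sum>i\<in>I. B i * w i) + t) mod int P < int g})"
    by auto
  moreover have "card \<dots> = (\<Sum>B\<in>PiE I (\<lambda>_. {0..<int P}).
      card {t \<in> {0..<int P}. (F + (\<Sum>i\<in>I. B i * w i) + t) mod int P < int g})"
    by (rule card_SigmaI) (use assms(1) in \<open>simp_all add: finite_PiE del: atLeastLessThan_iff\<close>)
  moreover have "\<dots> = (\<Sum>B\<in>PiE I (\<lambda>_. {0..<int P}). g)"
    by (simp only: card_mod_less[OF assms(2)])
  ultimately show ?thesis using assms(1) by (simp add: card_PiE)
qed

text \<open>Pairwise independence: among the \<open>P ^ (card I + 1)\<close> affine maps the two
  events hold together with probability at most \<open>(g / P)^2\<close>. Primality enters because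
  \<open>w i0 - w' i0\<close> has to be invertible modulo \<open>P\<close>.\<close>

lemma card_affine_mod_less_pair:
  assumes "finite I" "prime P" and i0: "i0 \<in> I" "w i0 \<noteq> w' i0" "\<bar>w i0 - w' i0\<bar> < int P"
  shows "card {x \<in> PiE I (\<lambda>_. {0..<int P}) \<times> {0..<int P}.
    (F + (\<Sum>i\<in>I. fst x i * w i) + snd x) mod int P < int g \<and>
    (F' + (\<Sum>i\<in>I. fst x i * w' i) + snd x) mod int P < int g} \<le> P ^ (card I - 1) * g\<^sup>2"
    (is "card ?S \<le> _")
proof -
  have P: "0 < P" using assms(2) prime_gt_0_nat by blast
  define val where "val = (\<lambda>f (v::'a \<Rightarrow> int) x. (f + (\<Sum>i\<in>I. fst x i * v i) + snd x) mod int P)"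
  \<comment> \<open>The coefficients other than the one at \<open>i0\<close>, together with the two
    residues, determine the map: subtracting the two congruences yields the coefficient at
    \<open>i0\<close>, and then the first one yields the translation.\<close>
  define h where "h = (\<lambda>x. (restrict (fst x) (I - {i0}), val F w x, val F' w' x))"
  have split: "(\<Sum>i\<in>I. (B::'a \<Rightarrow> int) i * v i) = B i0 * v i0 + (\<Sum>i\<in>I - {i0}. B i * v i)" for B v
    using assms(1) i0(1) by (simp add: sum.remove)
  have "inj_on h ?S"
  proof (rule inj_onI)
    fix x y assume x: "x \<in> ?S" and y: "y \<in> ?S" and h: "h x = h y"
    obtain B t B' t' where [simp]: "x = (B, t)" "y = (B', t')" by fastforce
    have eq: "B i = B' i" if "i \<in> I - {i0}" for i
      using h that unfolding h_def by (metis fst_conv restrict_apply' \<open>x = (B, t)\<close> \<open>y = (B', t')\<close>)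
    define r where "r = (\<lambda>v. \<Sum>i\<in>I - {i0}. B i * (v::'a \<Rightarrow> int) i)"
    have r': "(\<Sum>i\<in>I - {i0}. B' i * v i) = r v" for v
      unfolding r_def by (rule sum.cong) (use eq in auto)
    have c1: "int P dvd (F + (B i0 * w i0 + r w) + t) - (F + (B' i0 * w i0 + r w) + t')"
      using h by (intro mod_eq_dvd_iff[THEN iffD1]) (auto simp: h_def val_def split r' r_def)
    have c2: "int P dvd (F' + (B i0 * w' i0 + r w') + t) - (F' + (B' i0 * w' i0 + r w') + t')"
      using h by (intro mod_eq_dvd_iff[THEN iffD1]) (auto simp: h_def val_def split r' r_def)
    from dvd_diff[OF c1 c2] have "int P dvd (B i0 - B' i0) * (w i0 - w' i0)"
      by (simp add: algebra_simps)
    moreover have "\<not> int P dvd w i0 - w' i0"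
      using dvd_imp_le_int[of "w i0 - w' i0" "int P"] i0 by auto
    moreover have "prime (int P)" using assms(2) by simp
    ultimately have d: "int P dvd B i0 - B' i0" by (metis prime_dvd_mult_iff)
    have rng: "B i0 \<in> {0..<int P}" "B' i0 \<in> {0..<int P}" "t \<in> {0..<int P}" "t' \<in> {0..<int P}"
      using x y i0(1) by (auto simp: PiE_def Pi_def)
    have eqB0: "B i0 = B' i0" using d rng mod_eq_dvd_iff[of "B i0" "int P" "B' i0"] by auto
    with c1 have "int P dvd t - t'" by simp
    then have "t = t'" using rng mod_eq_dvd_iff[of t "int P" t'] by auto
    moreover have "B = B'"
    proof (rule PiE_ext)
      show "B \<in> PiE I (\<lambda>_. {0..<int P})" "B' \<in> PiE I (\<lambda>_. {0..<int P})" using x y by auto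
      show "B i = B' i" if "i \<in> I" for i using eq eqB0 that by (cases "i = i0") auto
    qed
    ultimately show "x = y" by simp
  qed
  moreover have "h ` ?S \<subseteq> PiE (I - {i0}) (\<lambda>_. {0..<int P}) \<times> {0..<int g} \<times> {0..<int g}"
    using P by (auto simp: h_def val_def PiE_def Pi_def)
  moreover have "finite (PiE (I - {i0}) (\<lambda>_. {0..<int P}) \<times> {0..<int g} \<times> {0..<int g})"
    using assms(1) by (intro finite_SigmaI finite_PiE) auto
  ultimately have "card ?S \<le> card (PiE (I - {i0}) (\<lambda>_. {0..<int P}) \<times> {0..<int g} \<times> {0..<int g})"
    by (rule card_inj_on_le)
  then show ?thesis
    using assms(1) i0(1) by (simp add: card_cartesian_product card_PiE power2_eq_square)
qed

text \<open>Averaging over all choices of \<open>B\<close> and \<open>T\<close>, independent for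
  each \<open>j\<close>. The mean number of successful points in a cell is \<mu>, so by the
  Bonferroni inequality a cell contains one with probability at least
  \<open>\<mu> - \<mu>\<^sup>2 / 2\<close>, and some choice does at least as well as the mean over
  all cells. The term \<open>F j c u\<close> may be arbitrary since it only translates a uniform
  residue; \<open>N \<le> P\<close> keeps distinct points of a cell distinct modulo
  \<open>P\<close>.\<close>

lemma exists_affine_shift_hitting_many_cells:
  fixes F :: "'j \<Rightarrow> 'c \<Rightarrow> ('i \<Rightarrow> int) \<Rightarrow> int" and z :: "'c \<Rightarrow> 'i \<Rightarrow> int"
  assumes fin: "finite I" "I \<noteq> {}" "finite J" "finite Cs" and P: "prime P" "N \<le> P" "g \<le> P"
  defines "\<mu> \<equiv> real N ^ card I * (real g / real P) ^ card J"
  obtains B T where "\<And>j i. j \<in> J \<Longrightarrow> i \<in> I \<Longrightarrow> 0 \<le> B j i \<and> B j i < int P"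
    "\<And>j. j \<in> J \<Longrightarrow> 0 \<le> T j \<and> T j < int P"
    "real (card Cs) * (\<mu> - \<mu>\<^sup>2 / 2) \<le> real (card {c \<in> Cs. \<exists>u \<in> PiE I (\<lambda>_. {0..<int N}).
      \<forall>j\<in>J. (F j c u + (\<Sum>i\<in>I. B j i * (z c i + u i)) + T j) mod int P < int g})"
proof -
  \<comment> \<open>\<open>Q1\<close> contains the possible rows of the affine map, linear
    coefficients with a translation; \<open>Q\<close> contains the choices of one row for each
    \<open>j\<close>.\<close>
  define Q1 where "Q1 = PiE I (\<lambda>_. {0..<int P}) \<times> {0..<int P}"
  define Q where "Q = PiE J (\<lambda>_. Q1)"
  define U where "U = PiE I (\<lambda>_. {0..<int N})"
  define good where "good = (\<lambda>j c u x. (F j c u + (\<Sum>i\<in>I. fst x i * (z c i + u i)) + snd x) mod int P < int g)"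
  define H where "H = (\<lambda>c u. {\<pi> \<in> Q. \<forall>j\<in>J. good j c u (\<pi> j)})"
  have P0: "0 < P" using P(1) prime_gt_0_nat by blast
  have finQ1: "finite Q1" using fin by (auto simp: Q1_def intro!: finite_PiE)
  have finQ: "finite Q" using fin finQ1 by (auto simp: Q_def intro!: finite_PiE)
  have finU: "finite U" using fin by (auto simp: U_def intro!: finite_PiE)
  have cardU: "card U = N ^ card I" using fin by (simp add: U_def card_PiE)
  have cardQ1: "card Q1 = P ^ card I * P" using fin by (simp add: Q1_def card_PiE card_cartesian_product)
  have cardQ: "card Q = (P ^ card I * P) ^ card J" using fin by (simp add: Q_def card_PiE cardQ1)
  have "(\<lambda>i\<in>I. 0, 0) \<in> Q1" using P0 by (auto simp: Q1_def)
  then have "(\<lambda>j\<in>J. (\<lambda>i\<in>I. 0, 0)) \<in> Q" by (auto simp: Q_def)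
  then have Qne: "Q \<noteq> {}" by blast
  have m: "P ^ card I = P * P ^ (card I - 1)"
    using fin by (metis card_gt_0_iff power_minus_mult mult.commute)
  have H1: "real (card (H c u)) = real (card Q) * (real g / real P) ^ card J" for c u
  proof -
    have "H c u = PiE J (\<lambda>j. {x \<in> Q1. good j c u x})"
      by (auto simp: H_def Q_def PiE_def Pi_def)
    moreover have "card {x \<in> Q1. good j c u x} = P ^ card I * g" for j
      unfolding Q1_def good_def by (rule card_affine_mod_less[OF fin(1) P(3)])
    ultimately have "card (H c u) = (P ^ card I * g) ^ card J" using fin by (simp add: card_PiE)
    then have "real (card (H c u)) = real (P ^ card I * g) ^ card J" by simp
    moreover have "real (P ^ card I * g) = real (P ^ card I * P) * (real g / real P)"
      using P0 by simp
    ultimately show ?thesis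
      unfolding cardQ of_nat_power by (simp only: power_mult_distrib)
  qed
  have H2: "real (card (H c u \<inter> H c u')) \<le> real (card Q) * ((real g / real P) ^ card J)\<^sup>2"
    if u: "u \<in> U" "u' \<in> U" "u \<noteq> u'" for c u u'
  proof -
    obtain i0 where i0: "i0 \<in> I" "u i0 \<noteq> u' i0"
      using PiE_ext[OF u(1,2)[unfolded U_def]] u(3) by metis
    have "u i0 \<in> {0..<int N}" "u' i0 \<in> {0..<int N}" using that i0 by (auto simp: U_def)
    then have lt: "\<bar>(z c i0 + u i0) - (z c i0 + u' i0)\<bar> < int P" using P(2) by auto
    have "H c u \<inter> H c u' = PiE J (\<lambda>j. {x \<in> Q1. good j c u x \<and> good j c u' x})"
      by (auto simp: H_def Q_def PiE_def Pi_def)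
    then have "card (H c u \<inter> H c u') = (\<Prod>j\<in>J. card {x \<in> Q1. good j c u x \<and> good j c u' x})"
      using fin by (simp add: card_PiE)
    also have "\<dots> \<le> (\<Prod>j\<in>J. P ^ (card I - 1) * g\<^sup>2)"
      unfolding Q1_def good_def
      by (intro prod_mono conjI card_affine_mod_less_pair[OF fin(1) P(1) i0(1)]) (use i0 lt in auto)
    finally have "card (H c u \<inter> H c u') \<le> (P ^ (card I - 1) * g\<^sup>2) ^ card J" by simp
    then have "real (card (H c u \<inter> H c u')) \<le> real (P ^ (card I - 1) * g\<^sup>2) ^ card J"
      by (metis of_nat_le_iff of_nat_power)
    also have "real (P ^ (card I - 1) * g\<^sup>2) = real (P ^ card I * P) * (real g / real P)\<^sup>2"
      unfolding m using P0 by (simp add: power2_eq_square)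
    also have "\<dots> ^ card J = real (card Q) * ((real g / real P) ^ card J)\<^sup>2"
      unfolding cardQ of_nat_power by (simp only: power_mult_distrib power_mult[symmetric] mult.commute)
    finally show ?thesis .
  qed
  have cell: "real (card Q) * (\<mu> - \<mu>\<^sup>2 / 2) \<le> real (card (\<Union>u\<in>U. H c u))" for c
  proof -
    have "real (card U) * (real (card Q) * (real g / real P) ^ card J) -
        (real (card U))\<^sup>2 * (real (card Q) * ((real g / real P) ^ card J)\<^sup>2) / 2
        \<le> real (card (\<Union>u\<in>U. H c u))"
      by (rule card_Union_pairwise_lower_bound[OF finU]) (use H1 H2 finQ in \<open>auto simp: H_def\<close>)
    then show ?thesis
      by (simp add: \<mu>_def cardU algebra_simps power_mult_distrib)
  qed
  define hits where "hits = (\<lambda>\<pi>. {c \<in> Cs. \<exists>u\<in>U. \<forall>j\<in>J. good j c u (\<pi> j)})"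
  \<comment> \<open>If every choice were below the bound, summing over \<open>Q\<close> and
    exchanging the sums over choices and cells would contradict \<open>cell\<close>.\<close>
  have "\<exists>\<pi>\<in>Q. real (card Cs) * (\<mu> - \<mu>\<^sup>2 / 2) \<le> real (card (hits \<pi>))"
  proof (rule ccontr)
    assume neg: "\<not> ?thesis"
    have "(\<Sum>\<pi>\<in>Q. real (card (hits \<pi>))) < (\<Sum>\<pi>\<in>Q. real (card Cs) * (\<mu> - \<mu>\<^sup>2 / 2))"
      by (rule sum_strict_mono) (use neg finQ Qne in \<open>auto simp: not_le\<close>)
    moreover have "(\<Sum>\<pi>\<in>Q. real (card (hits \<pi>))) = (\<Sum>c\<in>Cs. real (card (\<Union>u\<in>U. H c u)))"
    proof -
      have "(\<Sum>\<pi>\<in>Q. real (card (hits \<pi>))) =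
          (\<Sum>\<pi>\<in>Q. \<Sum>c\<in>Cs. if \<exists>u\<in>U. \<forall>j\<in>J. good j c u (\<pi> j) then 1 else 0)"
        using fin by (simp add: hits_def sum.If_cases Int_def)
      also have "\<dots> = (\<Sum>c\<in>Cs. \<Sum>\<pi>\<in>Q. if \<exists>u\<in>U. \<forall>j\<in>J. good j c u (\<pi> j) then 1 else 0)"
        by (rule sum.swap)
      also have "\<dots> = (\<Sum>c\<in>Cs. real (card {\<pi> \<in> Q. \<exists>u\<in>U. \<forall>j\<in>J. good j c u (\<pi> j)}))"
        using finQ by (simp add: sum.If_cases Int_def)
      also have "(\<lambda>c. {\<pi> \<in> Q. \<exists>u\<in>U. \<forall>j\<in>J. good j c u (\<pi> j)}) = (\<lambda>c. \<Union>u\<in>U. H c u)"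
        by (auto simp: H_def)
      finally show ?thesis by metis
    qed
    moreover have "(\<Sum>c\<in>Cs. real (card Q) * (\<mu> - \<mu>\<^sup>2 / 2)) \<le> (\<Sum>c\<in>Cs. real (card (\<Union>u\<in>U. H c u)))"
      by (rule sum_mono) (rule cell)
    ultimately show False by (simp add: mult_ac)
  qed
  then obtain \<pi> where \<pi>: "\<pi> \<in> Q" "real (card Cs) * (\<mu> - \<mu>\<^sup>2 / 2) \<le> real (card (hits \<pi>))" by blast
  have \<pi>Q1: "\<pi> j \<in> Q1" if "j \<in> J" for j using \<pi>(1) that by (auto simp: Q_def)
  show ?thesis
  proof (rule that[of "\<lambda>j. fst (\<pi> j)" "\<lambda>j. snd (\<pi> j)"])
    show "0 \<le> fst (\<pi> j) i \<and> fst (\<pi> j) i < int P" if "j \<in> J" "i \<in> I" for j i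
      using \<pi>Q1[OF that(1)] that(2) by (auto simp: Q1_def mem_Times_iff PiE_def Pi_def)
    show "0 \<le> snd (\<pi> j) \<and> snd (\<pi> j) < int P" if "j \<in> J" for j
      using \<pi>Q1[OF that(1)] by (auto simp: Q1_def mem_Times_iff)
  qed (use \<pi>(2) in \<open>simp add: hits_def good_def U_def\<close>)
qed

section \<open>Perturbation over one box\<close>

text \<open>The bumps will have radius of order \<open>N / q\<close> and height of order
  \<open>N powr (- m / d) / q\<close>. The inequality with \<eta> bounds their cost, the one with
  \<kappa> keeps the cells small against the box, and the last one says that the number of cells, of
  order \<open>(q / N) ^ m\<close>, reaches the exponent of the theorem.\<close>

lemma scale_parameter_exists:
  fixes m d k :: nat and \<eta> \<kappa> :: real
  assumes "1 \<le> m" "1 \<le> d" "2 \<le> k" "0 < \<eta>" "0 < \<kappa>"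
  obtains c Q where "0 < c" "\<And>q::nat. Q \<le> real q \<Longrightarrow> \<exists>N::nat. 1 \<le> N \<and> real N \<le> \<kappa> * real q \<and>
      (real q / real N) ^ k * (real N powr (- real m / real d) / real q) \<le> \<eta> \<and>
      c * real q powr (real (m * (m + d)) / real (m + k * d)) \<le> (real q / real N) ^ m"
proof -
  define E where "E = real (m + k * d)"
  define \<alpha> where "\<alpha> = real d / E"
  define \<beta> where "\<beta> = real (m + d) / E"
  define A where "A = 2 * \<eta> powr (- \<alpha>)"
  have E: "0 < E" using assms unfolding E_def of_nat_0_less_iff by simp
  have pos: "0 < \<alpha>" "0 < \<beta>" "0 < A" using assms E by (auto simp: \<alpha>_def \<beta>_def A_def)
  \<comment> \<open>Since \<open>x\<close> below is of order
    \<open>q powr ((k - 1) * \<alpha>)\<close>, this identity makes \<open>q / N\<close> of order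
    \<open>q powr \<beta>\<close>, and \<open>m * \<beta>\<close> is the required exponent.\<close>
  have \<alpha>\<beta>: "(real k - 1) * \<alpha> = 1 - \<beta>"
    using E by (simp add: \<alpha>_def \<beta>_def field_simps) (simp add: E_def algebra_simps)
  show ?thesis
  \<comment> \<open>The threshold makes \<open>x\<close> at least 1 and
    \<open>A / q powr \<beta>\<close> at most \<kappa>.\<close>
  proof (rule that[of "(1 / A) ^ m" "max (max 1 \<eta>) ((A / \<kappa>) powr (1 / \<beta>))"])
    show "0 < (1 / A) ^ m" using pos by simp
    fix q :: nat assume q: "max (max 1 \<eta>) ((A / \<kappa>) powr (1 / \<beta>)) \<le> real q"
    then have q1: "1 \<le> real q" "\<eta> \<le> real q" "(A / \<kappa>) powr (1 / \<beta>) \<le> real q" by auto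
    \<comment> \<open>The real solution of
      \<open>(q / x) ^ k * (x powr (- m / d) / q) = \<eta>\<close>. Rounding it up preserves the
      upper bound \<eta> and at most doubles it, whence the 2 in \<open>A\<close>.\<close>
    define x where "x = (real q ^ (k - 1) / \<eta>) powr \<alpha>"
    define N where "N = nat \<lceil>x\<rceil>"
    have "real q ^ 1 \<le> real q ^ (k - 1)" using q1 assms by (intro power_increasing) auto
    with q1(2) have "\<eta> \<le> real q ^ (k - 1)" by (metis order_trans power_one_right)
    then have "1 \<le> real q ^ (k - 1) / \<eta>" using assms(4) by (simp add: le_divide_eq)
    then have x1: "1 \<le> x" unfolding x_def using pos by (simp add: ge_one_powr_ge_zero)
    have Nx: "x \<le> real N" "real N \<le> 2 * x" "1 \<le> N"
      using x1 unfolding N_def by linarith+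
    have "x = real q powr ((real k - 1) * \<alpha>) * \<eta> powr (- \<alpha>)"
    proof -
      have "real q ^ (k - 1) = real q powr (real k - 1)"
        using q1 assms by (simp add: powr_realpow[symmetric] of_nat_diff)
      then show ?thesis using q1 assms
        by (simp add: x_def powr_divide powr_powr powr_minus field_simps)
    qed
    then have "2 * x = A * (real q powr (1 - \<beta>))" by (simp add: A_def \<alpha>\<beta>)
    also have "real q powr (1 - \<beta>) = real q / real q powr \<beta>"
      using q1 by (simp add: powr_diff)
    finally have NA: "real N \<le> A * real q / real q powr \<beta>" using Nx by simp
    have q\<beta>: "0 < real q powr \<beta>" using q1 by simp
    have "A / \<kappa> \<le> real q powr \<beta>"
    proof -
      have "((A / \<kappa>) powr (1 / \<beta>)) powr \<beta> \<le> real q powr \<beta>"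
        using q1 pos by (intro powr_mono2) auto
      then show ?thesis using pos assms by (simp add: powr_powr)
    qed
    then have "A * real q / real q powr \<beta> \<le> \<kappa> * real q"
      using assms q1 q\<beta> by (simp add: field_simps mult_right_mono)
    with NA have "real N \<le> \<kappa> * real q" by linarith
    moreover have "(real q / real N) ^ k * (real N powr (- real m / real d) / real q) \<le> \<eta>"
    proof -
      have "real q ^ (k - 1) / \<eta> = x powr (E / real d)"
        using assms E q1 by (simp add: x_def powr_powr \<alpha>_def)
      also have "\<dots> \<le> real N powr (E / real d)" using Nx x1 E by (intro powr_mono2) auto
      also have "E / real d = real k + real m / real d" using assms by (simp add: E_def field_simps)
      also have "real N powr \<dots> = real N ^ k * real N powr (real m / real d)"
        using Nx by (simp add: powr_add powr_realpow)
      finally have "real q ^ (k - 1) \<le> \<eta> * (real N ^ k * real N powr (real m / real d))"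
        using assms by (simp add: field_simps)
      moreover have "real q ^ k = real q * real q ^ (k - 1)"
        using assms by (metis not_numeral_le_zero power_eq_if)
      ultimately show ?thesis using Nx q1 assms
        by (simp add: power_divide powr_minus divide_simps)
    qed
    moreover have "(1 / A) ^ m * real q powr (real (m * (m + d)) / real (m + k * d)) \<le> (real q / real N) ^ m"
    proof -
      have "real q powr \<beta> / A \<le> real q / real N"
        using NA Nx pos q\<beta> q1 by (simp add: field_simps)
      then have "(real q powr \<beta> / A) ^ m \<le> (real q / real N) ^ m"
        using pos by (intro power_mono) auto
      moreover have "(real q powr \<beta>) ^ m = real q powr (real (m * (m + d)) / real (m + k * d))"
        using q1 by (simp add: powr_realpow[symmetric] powr_powr \<beta>_def E_def mult.commute)
      ultimately show ?thesis by (simp add: power_divide)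
    qed
    ultimately show "\<exists>N::nat. 1 \<le> N \<and> real N \<le> \<kappa> * real q \<and>
      (real q / real N) ^ k * (real N powr (- real m / real d) / real q) \<le> \<eta> \<and>
      (1 / A) ^ m * real q powr (real (m * (m + d)) / real (m + k * d)) \<le> (real q / real N) ^ m"
      using Nx(3) by blast
  qed
qed

text \<open>As \<open>P\<close> is at least \<open>2 / \<theta>\<close>, rounding
  \<open>P * \<theta>\<close> down to an integer loses at most half of it.\<close>

lemma prime_denominator_approx:
  fixes \<theta> :: real
  assumes "0 < \<theta>" "\<theta> \<le> 1"
  obtains P g :: nat where "prime P" "N \<le> P" "g \<le> P" "\<theta> / 2 \<le> real g / real P" "real g / real P \<le> \<theta>"
proof -
  obtain P where P: "prime P" "max N (nat \<lceil>2 / \<theta>\<rceil>) < P" using bigger_prime by blast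
  have P2: "2 / \<theta> \<le> real P" using P(2) by linarith
  define g where "g = nat \<lfloor>real P * \<theta>\<rfloor>"
  have "2 \<le> real P * \<theta>" using P2 assms by (simp add: field_simps)
  then have g: "real g \<le> real P * \<theta>" "real P * \<theta> / 2 \<le> real g" unfolding g_def by linarith+
  have P0: "0 < real P" using P(2) by simp
  have "real P * \<theta> \<le> real P" using assms P0 by (simp add: mult_left_le)
  with g(1) have "g \<le> P" by linarith
  with that[of P g] P P0 g show ?thesis by (simp add: field_simps)
qed

text \<open>The random affine map is applied to points of \<Sigma> over a grid of mesh
  \<open>s / q\<close>. On such a grid a slope \<open>B / (P * s)\<close> multiplies
  \<open>q * x $ i = s * (z + u)\<close> to \<open>B * (z + u) / P\<close>. Slopes of size at most
  \<open>1 / s\<close> therefore already give all residues modulo \<open>P\<close>, and a small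
  affine map suffices for full randomness.\<close>

lemma points_near_lattice:
  fixes \<Sigma> :: "(real^'n) set" and I :: "'n set" and a :: "real^'n"
  assumes I: "I \<noteq> {}" "I \<noteq> UNIV" and \<tau>: "0 < \<tau>"
    and cov: "\<forall>y. (\<forall>i\<in>I. \<bar>y $ i - a $ i\<bar> \<le> \<tau>) \<longrightarrow> (\<exists>\<sigma>\<in>\<Sigma>. \<forall>i\<in>I. \<sigma> $ i = y $ i)"
    and pos: "1 \<le> s" "1 \<le> q" "1 \<le> N" and L: "2 * real N * real L + 1 \<le> 2 * \<tau> * real q / real s"
  obtains A t X where "\<And>j i. \<bar>A j i\<bar> \<le> 1 / real s" "\<And>j. \<bar>t j\<bar> \<le> 1 / real q"
    "finite X" "X \<subseteq> \<Sigma>" "\<And>x i. x \<in> X \<Longrightarrow> i \<in> I \<Longrightarrow> \<bar>x $ i - a $ i\<bar> \<le> \<tau>"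
    "\<And>x i. x \<in> X \<Longrightarrow> i \<in> I \<Longrightarrow> \<exists>z::int. x $ i = z / real q"
    "\<And>x j. x \<in> X \<Longrightarrow> j \<notin> I \<Longrightarrow> \<exists>z::int. 0 \<le> real q * (x $ j + (\<Sum>i\<in>I. A j i * x $ i) + t j) - z \<and>
       real q * (x $ j + (\<Sum>i\<in>I. A j i * x $ i) + t j) - z \<le> real N powr (- real (card I) / real (card (-I)))"
    "\<And>x y. x \<in> X \<Longrightarrow> y \<in> X \<Longrightarrow> x \<noteq> y \<Longrightarrow> \<exists>i\<in>I. real N * real s / real q < \<bar>x $ i - y $ i\<bar>"
    "real L ^ card I * (1 / 2) ^ Suc (card (-I)) \<le> real (card X)"
proof -
  define m where "m = card I"
  define d where "d = card (-I)"
  have md: "0 < m" "0 < d" using I by (auto simp: m_def d_def card_gt_0_iff)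
  define \<theta> where "\<theta> = real N powr (- real m / real d)"
  have \<theta>: "0 < \<theta>" "\<theta> \<le> 1"
    using pos by (auto simp: \<theta>_def powr_minus intro!: inverse_le_1_iff[THEN iffD2] ge_one_powr_ge_zero)
  obtain P g where P: "prime P" "N \<le> P" "g \<le> P" "\<theta> / 2 \<le> real g / real P" "real g / real P \<le> \<theta>"
    using prime_denominator_approx[OF \<theta>] .
  have P0: "0 < P" using P(1) prime_gt_0_nat by blast
  define Cs where "Cs = PiE I (\<lambda>_. {0..<int L})"
  define U where "U = PiE I (\<lambda>_. {0..<int N})"
  \<comment> \<open>\<open>W i\<close> is the first grid index in the box. Cells are blocks of
    \<open>N\<close> indices in each direction, repeated with period \<open>2 * N\<close>, so that
    points of distinct cells differ by more than \<open>N\<close> in some index.\<close>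
  define W where "W = (\<lambda>i. \<lceil>real q * (a $ i - \<tau>) / real s\<rceil>)"
  define z where "z = (\<lambda>c i. W i + 2 * int N * c i)"
  \<comment> \<open>Any point of \<Sigma> over the grid point will do, since the counting lemma
    allows an arbitrary \<open>F\<close>.\<close>
  define pt where "pt = (\<lambda>c u. SOME \<sigma>. \<sigma> \<in> \<Sigma> \<and> (\<forall>i\<in>I. \<sigma> $ i = real s / real q * of_int (z c i + u i)))"
  \<comment> \<open>The height in units of \<open>1 / (P * q)\<close>, rounded down; less than one
    unit is lost.\<close>
  define F where "F = (\<lambda>j c u. \<lfloor>real P * real q * (pt c u $ j)\<rfloor>)"
  have sq: "0 < real s" "0 < real q" using pos by auto
  have near: "\<bar>real s / real q * of_int (z c i + u i) - a $ i\<bar> \<le> \<tau>" if "c \<in> Cs" "u \<in> U" "i \<in> I" for c u i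
  proof -
    define w where "w = z c i + u i"
    have cu: "0 \<le> c i" "c i \<le> int L - 1" "0 \<le> u i" "u i \<le> int N - 1"
      using that by (auto simp: Cs_def U_def PiE_def Pi_def)
    have nn: "0 \<le> 2 * int N * c i" using cu by simp
    have "2 * int N * c i \<le> 2 * int N * (int L - 1)" using cu by (intro mult_left_mono) auto
    then have "w \<le> W i + 2 * int N * int L" "W i \<le> w"
      using cu nn by (auto simp: w_def z_def algebra_simps)
    then have "real_of_int w \<le> of_int (W i) + 2 * real N * real L" "of_int (W i) \<le> real_of_int w"
      by (smt (verit) of_int_add of_int_le_iff of_int_mult of_int_numeral of_int_of_nat_eq)+
    moreover have "real q * (a $ i - \<tau>) / real s \<le> of_int (W i)"
      "of_int (W i) \<le> real q * (a $ i - \<tau>) / real s + 1"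
      unfolding W_def by linarith+
    ultimately have "real q * (a $ i - \<tau>) / real s \<le> w" "w \<le> real q * (a $ i - \<tau>) / real s + 2 * \<tau> * real q / real s"
      using L by linarith+
    then have "a $ i - \<tau> \<le> real s / real q * w" "real s / real q * w \<le> a $ i + \<tau>"
      using sq by (auto simp: field_simps)
    then show ?thesis unfolding w_def by linarith
  qed
  have pt: "pt c u \<in> \<Sigma>" "\<And>i. i \<in> I \<Longrightarrow> pt c u $ i = real s / real q * of_int (z c i + u i)"
    if "c \<in> Cs" "u \<in> U" for c u
  proof -
    have "\<exists>\<sigma>\<in>\<Sigma>. \<forall>i\<in>I. \<sigma> $ i = (\<chi> i. real s / real q * of_int (z c i + u i)) $ i"
      by (rule cov[rule_format]) (use near[OF that] in auto)
    then have "\<exists>\<sigma>. \<sigma> \<in> \<Sigma> \<and> (\<forall>i\<in>I. \<sigma> $ i = real s / real q * of_int (z c i + u i))"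
      by auto
    from someI_ex[OF this]
    have "pt c u \<in> \<Sigma> \<and> (\<forall>i\<in>I. pt c u $ i = real s / real q * of_int (z c i + u i))"
      unfolding pt_def .
    then show "pt c u \<in> \<Sigma>" "\<And>i. i \<in> I \<Longrightarrow> pt c u $ i = real s / real q * of_int (z c i + u i)" by auto
  qed
  have finCs: "finite Cs" by (auto simp: Cs_def intro!: finite_PiE)
  define \<mu> where "\<mu> = real N ^ card I * (real g / real P) ^ card (-I)"
  obtain B T where B: "\<And>j i. j \<in> -I \<Longrightarrow> i \<in> I \<Longrightarrow> 0 \<le> B j i \<and> B j i < int P"
    and T: "\<And>j. j \<in> -I \<Longrightarrow> 0 \<le> T j \<and> T j < int P"
    and hit: "real (card Cs) * (\<mu> - \<mu>\<^sup>2 / 2) \<le> real (card {c \<in> Cs. \<exists>u\<in>U.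
      \<forall>j\<in>-I. (F j c u + (\<Sum>i\<in>I. B j i * (z c i + u i)) + T j) mod int P < int g})"
    by (rule exists_affine_shift_hitting_many_cells
        [of I "-I" Cs P N g F z, OF finite I(1) finite finCs P(1,2,3), folded U_def \<mu>_def]) (rule that)
  define Hs where "Hs = {c \<in> Cs. \<exists>u\<in>U.
      \<forall>j\<in>-I. (F j c u + (\<Sum>i\<in>I. B j i * (z c i + u i)) + T j) mod int P < int g}"
  have "\<exists>u. \<forall>c\<in>Hs. u c \<in> U \<and>
      (\<forall>j\<in>-I. (F j c (u c) + (\<Sum>i\<in>I. B j i * (z c i + u c i)) + T j) mod int P < int g)"
    unfolding Hs_def by (rule bchoice) blast
  then obtain u where u: "\<And>c. c \<in> Hs \<Longrightarrow> u c \<in> U" "\<And>c j. c \<in> Hs \<Longrightarrow> j \<in> -I \<Longrightarrow>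
      (F j c (u c) + (\<Sum>i\<in>I. B j i * (z c i + u c i)) + T j) mod int P < int g" by blast
  have HsCs: "c \<in> Cs" if "c \<in> Hs" for c using that by (simp add: Hs_def)
  define x where "x = (\<lambda>c. pt c (u c))"
  have xI: "x c $ i = real s / real q * of_int (z c i + u c i)" if "c \<in> Hs" "i \<in> I" for c i
    unfolding x_def using pt(2)[OF HsCs u(1)] that by blast
  have sep: "\<exists>i\<in>I. real N * real s / real q < \<bar>x c $ i - x c' $ i\<bar>"
    if c: "c \<in> Hs" "c' \<in> Hs" "c \<noteq> c'" for c c'
  proof -
    obtain i where i: "i \<in> I" "c i \<noteq> c' i"
      using PiE_ext[of c I "\<lambda>_. {0..<int L}" c'] HsCs[OF c(1)] HsCs[OF c(2)] c(3) unfolding Cs_def by metis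
    define D where "D = (z c i + u c i) - (z c' i + u c' i)"
    have ur: "0 \<le> u c i" "u c i < int N" "0 \<le> u c' i" "u c' i < int N"
      using u(1)[OF c(1)] u(1)[OF c(2)] i by (auto simp: U_def PiE_def Pi_def)
    have D: "D = 2 * int N * (c i - c' i) + (u c i - u c' i)" by (simp add: D_def z_def algebra_simps)
    have "2 * int N * 1 \<le> 2 * int N * \<bar>c i - c' i\<bar>" using i by (intro mult_left_mono) auto
    then have "2 * int N \<le> \<bar>2 * int N * (c i - c' i)\<bar>" by (simp add: abs_mult)
    then have "int N < \<bar>D\<bar>" unfolding D using ur by linarith
    then have "real N < \<bar>real_of_int D\<bar>" by linarith
    then have "real N * (real s / real q) < \<bar>real_of_int D\<bar> * (real s / real q)"
      using sq by (intro mult_strict_right_mono) auto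
    also have "\<dots> = \<bar>real s / real q * real_of_int D\<bar>" using sq by (simp add: abs_mult)
    also have "real s / real q * real_of_int D = x c $ i - x c' $ i"
      using xI[OF c(1) i(1)] xI[OF c(2) i(1)] by (simp only: D_def of_int_diff right_diff_distrib)
    finally show ?thesis using i(1) by (intro bexI[of _ i]) simp_all
  qed
  have "inj_on x Hs"
  proof (rule inj_onI, rule ccontr)
    fix c c' assume "c \<in> Hs" "c' \<in> Hs" "x c = x c'" "c \<noteq> c'"
    then have "real N * real s / real q < 0" using sep[of c c'] by auto
    moreover have "0 \<le> real N * real s / real q" by simp
    ultimately show False by linarith
  qed
  then have cardX: "card (x ` Hs) = card Hs" by (rule card_image)
  define A where "A = (\<lambda>j i. if j \<in> -I \<and> i \<in> I then real_of_int (B j i) / (real P * real s) else 0)"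
  define t where "t = (\<lambda>j. if j \<in> -I then real_of_int (T j) / (real P * real q) else 0)"
  show ?thesis
  proof (rule that[of A t "x ` Hs"])
    show "\<bar>A j i\<bar> \<le> 1 / real s" for j i
    proof (cases "j \<in> -I \<and> i \<in> I")
      case True
      then have "0 \<le> real_of_int (B j i)" "real_of_int (B j i) \<le> real P" using B[of j i] by auto
      then show ?thesis using True sq P0 by (simp add: A_def field_simps)
    qed (use sq in \<open>auto simp: A_def\<close>)
    show "\<bar>t j\<bar> \<le> 1 / real q" for j
    proof (cases "j \<in> -I")
      case True
      then have "0 \<le> real_of_int (T j)" "real_of_int (T j) \<le> real P" using T[of j] by auto
      then show ?thesis using True sq P0 by (simp add: t_def field_simps)
    qed (use sq in \<open>auto simp: t_def\<close>)
    show "finite (x ` Hs)" using finCs by (simp add: Hs_def)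
    show "x ` Hs \<subseteq> \<Sigma>" using pt(1)[OF HsCs u(1)] by (auto simp: x_def)
    show "\<bar>y $ i - a $ i\<bar> \<le> \<tau>" if "y \<in> x ` Hs" "i \<in> I" for y i
      using that near[OF HsCs u(1)] xI by auto
    show "\<exists>l::int. y $ i = l / real q" if y: "y \<in> x ` Hs" and "i \<in> I" for y i
    proof -
      obtain c where c: "c \<in> Hs" "y = x c" using y by blast
      have "y $ i = of_int (int s * (z c i + u c i)) / real q"
        using xI[OF c(1) that(2)] c(2) by simp
      then show ?thesis by blast
    qed
    show "\<exists>i\<in>I. real N * real s / real q < \<bar>y $ i - y' $ i\<bar>"
      if "y \<in> x ` Hs" "y' \<in> x ` Hs" "y \<noteq> y'" for y y'
      using that sep by blast
    show "\<exists>l::int. 0 \<le> real q * (y $ j + (\<Sum>i\<in>I. A j i * y $ i) + t j) - l \<and>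
       real q * (y $ j + (\<Sum>i\<in>I. A j i * y $ i) + t j) - l \<le> real N powr (- real (card I) / real (card (-I)))"
      if y: "y \<in> x ` Hs" and j: "j \<notin> I" for y j
    proof -
      obtain c where c: "c \<in> Hs" "y = x c" using y by blast
      define S where "S = (\<Sum>i\<in>I. B j i * (z c i + u c i)) + T j"
      define Y where "Y = real P * real q * (x c $ j)"
      have sumA: "real q * (\<Sum>i\<in>I. A j i * y $ i) = (\<Sum>i\<in>I. real_of_int (B j i * (z c i + u c i)) / real P)"
        unfolding sum_distrib_left
      proof (rule sum.cong)
        fix i assume i: "i \<in> I"
        have "y $ i = real s / real q * of_int (z c i + u c i)" using xI[OF c(1) i] c(2) by simp
        then show "real q * (A j i * y $ i) = real_of_int (B j i * (z c i + u c i)) / real P"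
          using i j sq by (simp add: A_def)
      qed simp
      have tj: "real q * t j = real_of_int (T j) / real P" using j sq by (simp add: t_def)
      have qy: "real q * y $ j = Y / real P" using P0 c(2) by (simp add: Y_def)
      have "real q * (y $ j + (\<Sum>i\<in>I. A j i * y $ i) + t j) =
          real q * y $ j + real q * (\<Sum>i\<in>I. A j i * y $ i) + real q * t j"
        by (simp add: distrib_left)
      also have "\<dots> = (Y + real_of_int S) / real P"
        unfolding sumA tj qy
        by (simp only: S_def of_int_add of_int_sum sum_divide_distrib add_divide_distrib add.assoc)
      finally have val: "real q * (y $ j + (\<Sum>i\<in>I. A j i * y $ i) + t j) = (Y + real_of_int S) / real P" .
      define e where "e = (\<lfloor>Y\<rfloor> + S) mod int P"
      have e: "0 \<le> e" "e < int g"
        using u(2)[OF c(1), of j] j P0 by (auto simp: e_def S_def F_def Y_def x_def add.assoc)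
      have "\<lfloor>Y\<rfloor> + S = int P * ((\<lfloor>Y\<rfloor> + S) div int P) + e" by (simp add: e_def)
      then have "real_of_int (\<lfloor>Y\<rfloor> + S) = real P * of_int ((\<lfloor>Y\<rfloor> + S) div int P) + of_int e"
        by (metis of_int_add of_int_mult of_int_of_nat_eq)
      then have eq: "(Y + real_of_int S) / real P - of_int ((\<lfloor>Y\<rfloor> + S) div int P) = (of_int e + (Y - of_int \<lfloor>Y\<rfloor>)) / real P"
        using P0 by (simp add: field_simps)
      \<comment> \<open>The residue is an integer below \<open>g\<close>, hence at most
        \<open>g - 1\<close>, which leaves room for the fractional part of \<open>Y\<close>.\<close>
      have "0 \<le> of_int e + (Y - of_int \<lfloor>Y\<rfloor>)" "of_int e + (Y - of_int \<lfloor>Y\<rfloor>) \<le> real g"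
        using e by linarith+
      then have "0 \<le> (of_int e + (Y - of_int \<lfloor>Y\<rfloor>)) / real P"
        "(of_int e + (Y - of_int \<lfloor>Y\<rfloor>)) / real P \<le> real g / real P"
        by (auto intro: divide_right_mono)
      then show ?thesis
        using P(5) unfolding val \<theta>_def m_def d_def
        by (intro exI[of _ "(\<lfloor>Y\<rfloor> + S) div int P"]) (simp add: eq)
    qed
    \<comment> \<open>The exponent in \<theta> is chosen so that success probability \<theta> per
      coordinate would give one expected success in a cell. Passing to \<open>g / P\<close> costs at
      most a factor \<open>2 ^ d\<close>, and \<open>\<mu> \<le> 1\<close> gives
      \<open>\<mu> - \<mu>\<^sup>2 / 2 \<ge> \<mu> / 2\<close>.\<close>
    have Nm: "real N ^ m * \<theta> ^ d = 1"
      using pos md by (simp add: \<theta>_def powr_realpow[symmetric] powr_powr powr_minus field_simps)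
    have "real N ^ m * (\<theta> / 2) ^ d \<le> \<mu>" "\<mu> \<le> real N ^ m * \<theta> ^ d"
      unfolding \<mu>_def m_def d_def using P(4,5) \<theta>
      by (auto intro!: mult_left_mono power_mono)
    then have \<mu>: "(1 / 2) ^ d \<le> \<mu>" "\<mu> \<le> 1"
      using Nm by (auto simp: power_divide)
    have "0 \<le> \<mu>" using \<mu>(1) order_trans[OF _ \<mu>(1)] by simp
    then have "\<mu>\<^sup>2 \<le> \<mu>" using \<mu>(2) by (simp add: power2_eq_square mult_left_le)
    then have "(1 / 2) ^ Suc d \<le> \<mu> - \<mu>\<^sup>2 / 2" using \<mu>(1) by simp
    then have "real (card Cs) * (1 / 2) ^ Suc d \<le> real (card Cs) * (\<mu> - \<mu>\<^sup>2 / 2)"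
      by (intro mult_left_mono) auto
    also have "\<dots> \<le> real (card Hs)" using hit by (simp add: Hs_def)
    finally show "real L ^ card I * (1 / 2) ^ Suc (card (- I)) \<le> real (card (x ` Hs))"
      using cardX by (simp add: Cs_def card_PiE d_def)
  qed
qed

text \<open>The perturbation is a cut-off random affine map plus bumps that move the selected values
  onto the lattice, each part being allowed \<open>\<delta> / 2\<close>. The constant
  \<open>c\<close> may depend on the box and on \<delta>, but not on \<open>q\<close>.\<close>

lemma local_perturbation_with_rational_points:
  fixes \<Sigma> :: "(real^'n) set" and I :: "'n set" and a :: "real^'n"
  assumes I: "I \<noteq> {}" "I \<noteq> UNIV" and k: "2 \<le> k" and \<rho>: "0 < \<rho>" and \<delta>: "0 < \<delta>"
    and cov: "\<forall>y. (\<forall>i\<in>I. \<bar>y $ i - a $ i\<bar> < \<rho>) \<longrightarrow> (\<exists>\<sigma>\<in>\<Sigma>. \<forall>i\<in>I. \<sigma> $ i = y $ i)"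
  obtains c Q where "0 < c" "\<And>q::nat. Q \<le> real q \<Longrightarrow> \<exists>g X. Ck_bound k \<delta> g \<and>
      (\<forall>x y. (\<forall>i\<in>I. x $ i = y $ i) \<longrightarrow> g x = g y) \<and> (\<forall>x. \<forall>i\<in>I. g x $ i = 0) \<and>
      (\<forall>x. (\<exists>i\<in>I. \<rho> \<le> \<bar>x $ i - a $ i\<bar>) \<longrightarrow> g x = 0) \<and>
      finite X \<and> X \<subseteq> \<Sigma> \<and> (\<forall>x\<in>X. \<forall>i\<in>I. \<bar>x $ i - a $ i\<bar> < \<rho>) \<and>
      (\<forall>x\<in>X. \<forall>i. \<exists>z::int. (x + g x) $ i = z / real q) \<and>
      c * real q powr (real (card I * (card I + card (-I))) / real (card I + k * card (-I)))
        \<le> real (card X)"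
proof -
  define n where "n = real CARD('n)"
  have n1: "1 \<le> n" unfolding n_def by (simp add: Suc_leI)
  obtain b :: "real^'n \<Rightarrow> real" where b: "Ck_on k UNIV b" "\<And>x. x \<bullet> x \<le> 1 / 2 \<Longrightarrow> b x = 1"
    "\<And>x. 1 \<le> norm x \<Longrightarrow> b x = 0"
    using Ck_plateau_exists by blast
  obtain Cb where Cb: "Ck_bound k Cb b"
    using Ck_bound_compact_support[of k b 1] b by force
  have Cb1: "1 \<le> Cb" using Ck_bound_norm_le[OF Cb, of 0] b(2)[of 0] by simp
  define \<beta> where "\<beta> = cylinder_bump b I a \<rho>"
  obtain D where D: "Ck_bound k D \<beta>" "\<And>i. i \<in> I \<Longrightarrow> Ck_bound k D (\<lambda>y. \<beta> y * y $ i)"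
    using Ck_bound_cylinder_bump_mult_coord[OF b(1,3) \<rho>, of I a] unfolding \<beta>_def by blast
  have D0: "0 \<le> D" using Ck_bound_nonneg[OF D(1)] .
  \<comment> \<open>On the smaller box of half-side \<tau> the cutoff \<beta> equals 1, so that the
    affine part acts there unmodified.\<close>
  define \<tau> where "\<tau> = \<rho> / (2 * n)"
  have \<tau>: "0 < \<tau>" "\<tau> \<le> \<rho> / 2" using \<rho> n1 by (auto simp: \<tau>_def field_simps)
  \<comment> \<open>All coefficients of the affine part will be at most \<open>1 / s\<close>, and
    \<open>s\<close> is large enough for it to cost at most \<open>\<delta> / 2\<close>. The lower
    bound 2 makes the bump radius \<open>r\<close> at least \<open>N / q\<close>.\<close>
  obtain s :: nat where s: "max 2 (2 * (n * ((n + 1) * D)) / \<delta>) < real s"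
    using reals_Archimedean2 by blast
  then have s2: "2 < real s" "2 * (n * ((n + 1) * D)) / \<delta> < real s" by auto
  have sD: "n * ((n + 1) * (1 / real s * D)) \<le> \<delta> / 2"
    using s2 \<delta> by (simp add: field_simps)
  define \<eta> where "\<eta> = \<delta> / (2 * n * Cb)"
  have \<eta>: "0 < \<eta>" using \<delta> n1 Cb1 by (simp add: \<eta>_def)
  \<comment> \<open>The three bounds ensure in turn that at least one cell fits into the box, that
    the bump radius is at most 1, and that it is at most \<open>\<rho> / 2\<close>.\<close>
  define \<kappa> where "\<kappa> = min (\<tau> / (2 * real s)) (min (2 / real s) (\<rho> / real s))"
  have \<kappa>: "0 < \<kappa>" "\<kappa> \<le> \<tau> / (2 * real s)" "\<kappa> \<le> 2 / real s" "\<kappa> \<le> \<rho> / real s"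
    using \<tau> s2 \<rho> by (auto simp: \<kappa>_def)
  define m where "m = card I"
  define d where "d = card (-I)"
  have md: "1 \<le> m" "1 \<le> d" using I by (auto simp: m_def d_def Suc_le_eq card_gt_0_iff)
  obtain c0 Q0 where c0: "0 < c0" and Q0: "\<And>q::nat. Q0 \<le> real q \<Longrightarrow> \<exists>N::nat. 1 \<le> N \<and> real N \<le> \<kappa> * real q \<and>
      (real q / real N) ^ k * (real N powr (- real m / real d) / real q) \<le> \<eta> \<and>
      c0 * real q powr (real (m * (m + d)) / real (m + k * d)) \<le> (real q / real N) ^ m"
    using scale_parameter_exists[OF md k \<eta> \<kappa>(1)] by blast
  define c where "c = (\<tau> / (4 * real s)) ^ m * (1 / 2) ^ Suc d * c0"
  show ?thesis
  \<comment> \<open>The threshold includes \<open>s\<close> so that the translations, at most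
    \<open>1 / q\<close>, are also at most \<open>1 / s\<close>.\<close>
  proof (rule that[of c "max Q0 (real s)"])
    show "0 < c" using c0 \<tau> s2 by (simp add: c_def)
    fix q :: nat assume "max Q0 (real s) \<le> real q"
    then have q: "Q0 \<le> real q" "real s \<le> real q" by auto
    have q0: "0 < real q" "0 < real s" using q s2 by auto
    obtain N :: nat where N: "1 \<le> N" "real N \<le> \<kappa> * real q"
      "(real q / real N) ^ k * (real N powr (- real m / real d) / real q) \<le> \<eta>"
      "c0 * real q powr (real (m * (m + d)) / real (m + k * d)) \<le> (real q / real N) ^ m"
      using Q0[OF q(1)] by blast
    have N0: "0 < real N" using N(1) by simp
    define L where "L = nat \<lfloor>\<tau> * real q / (2 * real s * real N)\<rfloor>"
    have NL: "real N \<le> \<tau> / (2 * real s) * real q"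
      using N(2) mult_right_mono[OF \<kappa>(2), of "real q"] q0 by linarith
    then have ge1: "1 \<le> \<tau> * real q / (2 * real s * real N)"
      using N0 q0 by (simp add: field_simps)
    have floor_bounds: "real (nat \<lfloor>x\<rfloor>) \<le> x" "x / 2 \<le> real (nat \<lfloor>x\<rfloor>)" if "1 \<le> x" for x :: real
      using that le_floor_iff[of 1 x] by linarith+
    have L: "real L \<le> \<tau> * real q / (2 * real s * real N)"
        "\<tau> * real q / (4 * real s * real N) \<le> real L"
      using floor_bounds[OF ge1] by (simp_all add: L_def)
    have fit: "2 * real N * real L + 1 \<le> 2 * \<tau> * real q / real s"
    proof -
      have NLL: "2 * real N * real L \<le> \<tau> * real q / real s"
        using L(1) N0 q0 by (simp add: field_simps)
      have "1 \<le> real N" using N(1) by simp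
      with NL have "1 \<le> \<tau> * real q / real s / 2" by simp
      moreover have "1 \<le> y" if "1 \<le> y / 2" for y :: real using that by linarith
      ultimately have "1 \<le> \<tau> * real q / real s" by blast
      moreover have "2 * \<tau> * real q / real s = 2 * (\<tau> * real q / real s)" by simp
      ultimately show ?thesis using NLL by linarith
    qed
    have cov': "\<forall>y. (\<forall>i\<in>I. \<bar>y $ i - a $ i\<bar> \<le> \<tau>) \<longrightarrow> (\<exists>\<sigma>\<in>\<Sigma>. \<forall>i\<in>I. \<sigma> $ i = y $ i)"
      using cov \<tau> \<rho> by (smt (verit) field_sum_of_halves)
    define \<theta> where "\<theta> = real N powr (- real m / real d)"
    have nat1: "1 \<le> s" "1 \<le> q" using q0 by simp_all
    obtain A t X where A: "\<And>j i. \<bar>A j i\<bar> \<le> 1 / real s" and t: "\<And>j. \<bar>t j\<bar> \<le> 1 / real q"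
      and X: "finite X" "X \<subseteq> \<Sigma>" "\<And>x i. x \<in> X \<Longrightarrow> i \<in> I \<Longrightarrow> \<bar>x $ i - a $ i\<bar> \<le> \<tau>"
      and XI: "\<And>x i. x \<in> X \<Longrightarrow> i \<in> I \<Longrightarrow> \<exists>z::int. x $ i = z / real q"
      and XJ: "\<And>x j. x \<in> X \<Longrightarrow> j \<notin> I \<Longrightarrow> \<exists>z::int. 0 \<le> real q * (x $ j + (\<Sum>i\<in>I. A j i * x $ i) + t j) - z \<and>
         real q * (x $ j + (\<Sum>i\<in>I. A j i * x $ i) + t j) - z \<le> \<theta>"
      and sep: "\<And>x y. x \<in> X \<Longrightarrow> y \<in> X \<Longrightarrow> x \<noteq> y \<Longrightarrow> \<exists>i\<in>I. real N * real s / real q < \<bar>x $ i - y $ i\<bar>"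
      and cardX: "real L ^ m * (1 / 2) ^ Suc d \<le> real (card X)"
      by (rule points_near_lattice[OF I \<tau>(1) cov' nat1 N(1) fit, folded m_def d_def, folded \<theta>_def]) (rule that)
    define val where "val = (\<lambda>x j. x $ j + (\<Sum>i\<in>I. A j i * x $ i) + t j)"
    have "\<exists>Z. \<forall>x j. x \<in> X \<longrightarrow> j \<notin> I \<longrightarrow>
        0 \<le> real q * val x j - real_of_int (Z x j) \<and> real q * val x j - real_of_int (Z x j) \<le> \<theta>"
      unfolding val_def by (intro choice allI) (use XJ in blast)
    then obtain Z :: "real^'n \<Rightarrow> 'n \<Rightarrow> int" where Z: "\<And>x j. x \<in> X \<Longrightarrow> j \<notin> I \<Longrightarrow> 0 \<le> real q * val x j - real_of_int (Z x j)"
      "\<And>x j. x \<in> X \<Longrightarrow> j \<notin> I \<Longrightarrow> real q * val x j - real_of_int (Z x j) \<le> \<theta>" by auto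
    \<comment> \<open>The displacement from the value \<open>val x j\<close> to the lattice value
      \<open>Z x j / q\<close>.\<close>
    define v :: "real^'n \<Rightarrow> real^'n" where
      "v = (\<lambda>x. \<chi> j. if j \<in> I then 0 else - (real q * val x j - real_of_int (Z x j)) / real q)"
    \<comment> \<open>Half the guaranteed separation of the points of \<open>X\<close>.\<close>
    define r where "r = real N * real s / (2 * real q)"
    have r: "0 < r" "r \<le> 1" "r \<le> \<rho> / 2" "real N / real q \<le> r"
    proof -
      have "real N \<le> 2 / real s * real q" "real N \<le> \<rho> / real s * real q"
        using N(2) mult_right_mono[OF \<kappa>(3), of "real q"] mult_right_mono[OF \<kappa>(4), of "real q"] q0 by linarith+
      then show "r \<le> 1" "r \<le> \<rho> / 2" using q0 by (auto simp: r_def field_simps)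
      show "0 < r" using q0 N0 by (simp add: r_def)
      show "real N / real q \<le> r" using q0 N0 s2 by (simp add: r_def field_simps)
    qed
    have r2: "2 * r = real N * real s / real q" by (simp add: r_def)
    have \<theta>0: "0 \<le> \<theta>" by (simp add: \<theta>_def)
    have nv: "norm (v x) \<le> n * (\<theta> / real q)" if "x \<in> X" for x
    proof -
      have "\<bar>v x $ j\<bar> \<le> \<theta> / real q" for j
        using Z[OF that, of j] q0 \<theta>0 by (auto simp: v_def divide_right_mono abs_divide)
      then have "(\<Sum>j\<in>UNIV. \<bar>v x $ j\<bar>) \<le> (\<Sum>j\<in>(UNIV::'n set). \<theta> / real q)" by (intro sum_mono)
      then show ?thesis using norm_le_l1_cart[of "v x"] by (simp add: n_def)
    qed
    define bumps where "bumps = (\<lambda>y. \<Sum>x\<in>X. cylinder_bump b I x r y *\<^sub>R v x)"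
    define g where "g = (\<lambda>y. affine_cutoff \<beta> I A t y + bumps y)"
    have "Ck_bound k (\<delta> / 2) (affine_cutoff \<beta> I A t)"
    proof (rule Ck_bound_affine_cutoff[OF D A])
      have "1 / real q \<le> 1 / real s" using q q0 by (simp add: frac_le)
      then show "\<bar>t j\<bar> \<le> 1 / real s" for j using t[of j] by linarith
      show "real CARD('n) * ((real CARD('n) + 1) * (1 / real s * D)) \<le> \<delta> / 2"
        using sD unfolding n_def .
    qed
    moreover have "Ck_bound k (\<delta> / 2) bumps"
      unfolding bumps_def
    proof (rule Ck_bound_separated_bumps[OF Cb b(3) r(1,2) X(1) nv])
      show "0 \<le> n * (\<theta> / real q)" using n1 \<theta>0 by simp
      show "\<exists>i\<in>I. 2 * r < \<bar>x $ i - y $ i\<bar>" if "x \<in> X" "y \<in> X" "x \<noteq> y" for x y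
        using sep[OF that] unfolding r2 .
      have "(real N / real q) ^ k \<le> r ^ k" using r(4) by (intro power_mono) auto
      moreover have "0 < (real N / real q) ^ k" using N0 q0 by simp
      ultimately have "Cb / r ^ k \<le> Cb / (real N / real q) ^ k"
        using Cb1 r(1) by (intro divide_left_mono mult_pos_pos) auto
      also have "\<dots> = Cb * (real q / real N) ^ k"
        by (simp add: power_divide)
      finally have "n * (\<theta> / real q) * (Cb / r ^ k) \<le> n * (\<theta> / real q) * (Cb * (real q / real N) ^ k)"
        using n1 \<theta>0 by (intro mult_left_mono) auto
      also have "\<dots> = n * Cb * ((real q / real N) ^ k * (\<theta> / real q))" by (simp add: mult_ac)
      also have "\<dots> \<le> n * Cb * \<eta>"
        using N(3) n1 Cb1 unfolding \<theta>_def by (intro mult_left_mono) auto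
      also have "\<dots> = \<delta> / 2" using n1 Cb1 by (simp add: \<eta>_def)
      finally show "n * (\<theta> / real q) * (Cb / r ^ k) \<le> \<delta> / 2" .
    qed auto
    ultimately have "Ck_bound k \<delta> g"
      using Ck_bound_add[of k "\<delta> / 2" "affine_cutoff \<beta> I A t" "\<delta> / 2" bumps] by (simp add: g_def)
    moreover have "g x = g y" if xy: "\<forall>i\<in>I. x $ i = y $ i" for x y
    proof -
      have cb: "cylinder_bump b I x' r' x = cylinder_bump b I x' r' y" for x' r'
        by (rule cylinder_bump_cong) (use xy in auto)
      have "(\<Sum>i\<in>I. A j i * x $ i) = (\<Sum>i\<in>I. A j i * y $ i)" for j
        by (rule sum.cong) (use xy in auto)
      then have "affine_cutoff \<beta> I A t x = affine_cutoff \<beta> I A t y"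
        by (simp add: vec_eq_iff affine_cutoff_nth \<beta>_def cb)
      then show ?thesis by (simp add: g_def bumps_def cb)
    qed
    moreover have gI: "g x $ i = 0" if "i \<in> I" for x i
      using that by (simp add: g_def bumps_def affine_cutoff_nth v_def)
    moreover have "g x = 0" if x: "\<exists>i\<in>I. \<rho> \<le> \<bar>x $ i - a $ i\<bar>" for x
    proof -
      obtain i where i: "i \<in> I" "\<rho> \<le> \<bar>x $ i - a $ i\<bar>" using x by blast
      have "\<beta> x = 0" unfolding \<beta>_def by (rule cylinder_bump_eq_0[OF b(3) \<rho> i])
      then have "affine_cutoff \<beta> I A t x = 0" by (simp add: vec_eq_iff affine_cutoff_nth)
      moreover have "cylinder_bump b I y r x = 0" if "y \<in> X" for y
      proof (rule cylinder_bump_eq_0[OF b(3) r(1) i(1)])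
        show "r \<le> \<bar>x $ i - y $ i\<bar>" using X(3)[OF that i(1)] i(2) r(3) \<tau>(2) by linarith
      qed
      ultimately show ?thesis by (simp add: g_def bumps_def)
    qed
    moreover have "\<bar>x $ i - a $ i\<bar> < \<rho>" if "x \<in> X" "i \<in> I" for x i
      using X(3)[OF that] \<tau> \<rho> by linarith
    moreover have "\<exists>z::int. (x + g x) $ i = z / real q" if x: "x \<in> X" for x i
    proof (cases "i \<in> I")
      case True
      then show ?thesis using XI[OF x True] gI[OF True] by simp
    next
      case False
      have "\<beta> x = 1"
        unfolding \<beta>_def by (rule cylinder_bump_eq_1[OF b(2) \<rho>]) (use X(3)[OF x] in \<open>auto simp: \<tau>_def n_def\<close>)
      moreover have "bumps x = v x"
      proof -
        have "cylinder_bump b I y r x *\<^sub>R v y = 0" if "y \<in> X - {x}" for y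
        proof -
          obtain l where l: "l \<in> I" "2 * r < \<bar>x $ l - y $ l\<bar>"
            using sep[OF x, of y] \<open>y \<in> X - {x}\<close> unfolding r2 by blast
          have "r \<le> \<bar>x $ l - y $ l\<bar>" using l(2) r(1) by linarith
          from cylinder_bump_eq_0[OF b(3) r(1) l(1) this] show ?thesis by simp
        qed
        then have "(\<Sum>y\<in>X - {x}. cylinder_bump b I y r x *\<^sub>R v y) = 0" by (rule sum.neutral[OF ballI])
        then have "bumps x = cylinder_bump b I x r x *\<^sub>R v x"
          unfolding bumps_def using X(1) x by (simp add: sum.remove)
        moreover have "cylinder_bump b I x r x = 1"
          by (rule cylinder_bump_eq_1[OF b(2) r(1)]) (use r in auto)
        ultimately show ?thesis by simp
      qed
      ultimately have "(x + g x) $ i = val x i + v x $ i"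
        using False by (simp add: g_def affine_cutoff_nth val_def)
      also have "\<dots> = Z x i / real q" using False q0 by (simp add: v_def field_simps)
      finally show ?thesis by blast
    qed
    moreover have "c * real q powr (real (m * (m + d)) / real (m + k * d)) \<le> real (card X)"
    proof -
      have "(\<tau> / (4 * real s)) ^ m * (real q / real N) ^ m = (\<tau> * real q / (4 * real s * real N)) ^ m"
        by (simp add: power_mult_distrib[symmetric])
      also have "\<dots> \<le> real L ^ m" using L(2) \<tau> q0 by (intro power_mono) auto
      finally have LL: "(\<tau> / (4 * real s)) ^ m * (real q / real N) ^ m \<le> real L ^ m" .
      have "(\<tau> / (4 * real s)) ^ m * (c0 * real q powr (real (m * (m + d)) / real (m + k * d)))
          \<le> (\<tau> / (4 * real s)) ^ m * (real q / real N) ^ m"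
        using N(4) \<tau> by (intro mult_left_mono) auto
      with LL have "(\<tau> / (4 * real s)) ^ m * (c0 * real q powr (real (m * (m + d)) / real (m + k * d))) * (1 / 2) ^ Suc d
          \<le> real L ^ m * (1 / 2) ^ Suc d"
        by (intro mult_right_mono) auto
      then have "(\<tau> / (4 * real s)) ^ m * (c0 * real q powr (real (m * (m + d)) / real (m + k * d))) * (1 / 2) ^ Suc d
          \<le> real (card X)"
        using cardX by (rule order_trans)
      then show ?thesis unfolding c_def by (simp only: mult_ac)
    qed
    ultimately show "\<exists>g X. Ck_bound k \<delta> g \<and>
      (\<forall>x y. (\<forall>i\<in>I. x $ i = y $ i) \<longrightarrow> g x = g y) \<and> (\<forall>x. \<forall>i\<in>I. g x $ i = 0) \<and>
      (\<forall>x. (\<exists>i\<in>I. \<rho> \<le> \<bar>x $ i - a $ i\<bar>) \<longrightarrow> g x = 0) \<and>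
      finite X \<and> X \<subseteq> \<Sigma> \<and> (\<forall>x\<in>X. \<forall>i\<in>I. \<bar>x $ i - a $ i\<bar> < \<rho>) \<and>
      (\<forall>x\<in>X. \<forall>i. \<exists>z::int. (x + g x) $ i = z / real q) \<and>
      c * real q powr (real (card I * (card I + card (-I))) / real (card I + k * card (-I)))
        \<le> real (card X)"
      using X(1,2) unfolding m_def d_def by (intro exI[of _ g] exI[of _ X] conjI) auto
  qed
qed

section \<open>Superposition over a sequence of boxes\<close>

text \<open>Charts are carried over by composing them with the inverse of \<Phi>.\<close>

lemma Ck_submanifold_diffeo_image:
  assumes \<Phi>: "Ck_diffeo k UNIV UNIV \<Phi>" and S: "Ck_submanifold k m S"
  shows "Ck_submanifold k m (\<Phi> ` S)"
  unfolding Ck_submanifold_def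
proof
  fix p' assume "p' \<in> \<Phi> ` S"
  then obtain p where p: "p \<in> S" "p' = \<Phi> p" by blast
  obtain U V \<phi> L where U: "p \<in> U" and \<phi>: "Ck_diffeo k U V \<phi>" and L: "subspace L" "dim L = m"
    and im: "\<phi> ` (U \<inter> S) = V \<inter> L"
    using S p(1) unfolding Ck_submanifold_def by blast
  define \<Psi> where "\<Psi> = inv_into UNIV \<Phi>"
  have bij: "bij \<Phi>" and Ck\<Phi>: "Ck_on k UNIV \<Phi>" and Ck\<Psi>: "Ck_on k UNIV \<Psi>"
    using \<Phi> by (auto simp: Ck_diffeo_def \<Psi>_def)
  have \<Psi>\<Phi>: "\<Psi> (\<Phi> x) = x" for x using bij by (simp add: \<Psi>_def bij_is_inj)
  have \<Phi>\<Psi>: "\<Phi> (\<Psi> y) = y" for y using bij by (simp add: \<Psi>_def bij_is_surj surj_f_inv_f)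
  have op: "open U" "open V" and bij\<phi>: "bij_betw \<phi> U V" and Ck\<phi>: "Ck_on k U \<phi>"
    and Ck\<phi>': "Ck_on k V (inv_into U \<phi>)"
    using \<phi> by (auto simp: Ck_diffeo_def)
  define U' where "U' = \<Phi> ` U"
  have U'eq: "U' = \<Psi> -` U" using \<Psi>\<Phi> \<Phi>\<Psi> by (auto simp: U'_def image_iff) metis
  have opU': "open U'"
    unfolding U'eq using op(1) Ck_on_imp_continuous_on[OF Ck\<Psi>] by (rule open_vimage)
  define \<phi>' where "\<phi>' = (\<lambda>x. \<phi> (\<Psi> x))"
  have "bij_betw \<Psi> U' U"
    by (rule bij_betw_byWitness[where f'=\<Phi>]) (auto simp: \<Psi>\<Phi> \<Phi>\<Psi> U'_def)
  from bij_betw_trans[OF this bij\<phi>] have bij': "bij_betw \<phi>' U' V"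
    by (simp add: \<phi>'_def comp_def)
  have inv': "\<Phi> (inv_into U \<phi> v) = inv_into U' \<phi>' v" if "v \<in> V" for v
  proof (rule inv_into_f_eq[symmetric])
    have "inv_into U \<phi> v \<in> U" using bij\<phi> that by (metis bij_betw_def inv_into_into)
    then show "\<Phi> (inv_into U \<phi> v) \<in> U'" by (simp add: U'_def)
    show "\<phi>' (\<Phi> (inv_into U \<phi> v)) = v"
      using bij\<phi> that by (simp add: \<phi>'_def \<Psi>\<Phi> bij_betw_inv_into_right)
  qed (use bij' in \<open>simp add: bij_betw_def\<close>)
  have "Ck_on k U' \<phi>'"
    unfolding \<phi>'_def
    by (rule Ck_on_compose[OF opU' op(1) _ Ck_on_subset[OF Ck\<Psi> subset_UNIV] Ck\<phi>]) (auto simp: U'eq)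
  moreover have "Ck_on k V (inv_into U' \<phi>')"
    using Ck_on_compose[OF op(2) open_UNIV subset_UNIV Ck\<phi>' Ck\<Phi>] inv'
    by (intro Ck_on_cong[OF op(2) inv'])
  ultimately have "Ck_diffeo k U' V \<phi>'"
    using opU' op(2) bij' by (simp add: Ck_diffeo_def)
  moreover have "\<phi>' ` (U' \<inter> \<Phi> ` S) = V \<inter> L"
  proof -
    have "U' \<inter> \<Phi> ` S = \<Phi> ` (U \<inter> S)" unfolding U'_def using bij by (simp add: bij_is_inj image_Int)
    then show ?thesis using im by (simp add: image_image \<phi>'_def \<Psi>\<Phi>)
  qed
  moreover have "p' \<in> U'" using p U by (simp add: U'_def)
  ultimately show "\<exists>U V \<phi> L. p' \<in> U \<and> Ck_diffeo k U V \<phi> \<and> subspace L \<and> dim L = m \<and>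
      \<phi> ` (U \<inter> \<Phi> ` S) = V \<inter> L"
    using L by blast
qed

text \<open>Bounded coordinates leave finitely many numerators. Finiteness matters for lower bounds
  because \<open>card\<close> of an infinite set is 0.\<close>

lemma finite_rat_points:
  fixes S :: "(real^'n) set"
  assumes "bounded S"
  shows "finite (rat_points q S)"
proof -
  obtain B where B: "\<And>x. x \<in> S \<Longrightarrow> norm x \<le> B" using assms by (auto simp: bounded_iff)
  define K where "K = \<lceil>B * real q\<rceil>"
  \<comment> \<open>For \<open>q = 0\<close> every quotient is 0 by convention; the inserted 0
    settles that case.\<close>
  define T where "T = insert 0 ((\<lambda>z::int. real_of_int z / real q) ` {-K..K})"
  have "rat_points q S \<subseteq> vec_lambda ` (PiE UNIV (\<lambda>_::'n. T))"
  proof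
    fix x assume x: "x \<in> rat_points q S"
    have "x $ i \<in> T" for i
    proof (cases "q = 0")
      case True
      then show ?thesis using x by (auto simp: rat_points_def T_def)
    next
      case False
      obtain z :: int where z: "x $ i = real_of_int z / real q" using x by (auto simp: rat_points_def)
      have "\<bar>x $ i\<bar> \<le> B" using component_le_norm_cart[of x i] B[of x] x by (auto simp: rat_points_def)
      then have "\<bar>real_of_int z\<bar> \<le> B * real q" using z False by (simp add: field_simps)
      then have "z \<in> {-K..K}" unfolding K_def by (simp add: abs_le_iff) linarith
      then show ?thesis using z unfolding T_def by blast
    qed
    then show "x \<in> vec_lambda ` (PiE UNIV (\<lambda>_. T))"
      by (intro image_eqI[of _ _ "vec_nth x"]) auto
  qed
  then show ?thesis
    by (rule finite_subset) (auto simp: T_def intro!: finite_imageI finite_PiE)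
qed

text \<open>\<open>G\<close> depends only on the coordinates in \<open>I\<close> and does not change
  them, so it takes the same value at \<open>x\<close> and at \<open>x + G x\<close>. Hence
  \<open>x - G x\<close> is the inverse, of the same class.\<close>

lemma Ck_diffeo_shear:
  assumes G: "Ck_on k UNIV G" "\<And>x y. (\<And>i. i \<in> I \<Longrightarrow> x $ i = y $ i) \<Longrightarrow> G x = G y"
    "\<And>x i. i \<in> I \<Longrightarrow> G x $ i = 0"
  shows "Ck_diffeo k UNIV UNIV (\<lambda>x::real^'n. x + G x)"
proof -
  have G1: "G (x + G x) = G x" "G (x - G x) = G x" for x using G(3) by (auto intro!: G(2))
  have bij: "bij (\<lambda>x. x + G x)"
    by (rule bij_betw_byWitness[where f'="\<lambda>x. x - G x"]) (auto simp: G1)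
  moreover have "inv_into UNIV (\<lambda>x. x + G x) = (\<lambda>x. x + (-1) *\<^sub>R G x)"
    by (rule ext, rule inv_f_eq) (use bij G1 in \<open>auto simp: bij_is_inj\<close>)
  moreover have "Ck_on k UNIV (\<lambda>x. x + G x)"
    by (intro Ck_on_add Ck_on_bounded_linear bounded_linear_ident open_UNIV G)
  moreover have "Ck_on k UNIV (\<lambda>x. x + (-1) *\<^sub>R G x)"
    by (intro Ck_on_add Ck_on_scaleR Ck_on_const Ck_on_bounded_linear bounded_linear_ident open_UNIV G)
  ultimately show ?thesis by (simp add: Ck_diffeo_def)
qed

lemma prod_list_le_1:
  fixes xs :: "real list"
  assumes "\<And>x. x \<in> set xs \<Longrightarrow> 0 \<le> x \<and> x \<le> 1"
  shows "0 \<le> prod_list xs \<and> prod_list xs \<le> 1"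
  using assms by (induction xs) (auto intro: mult_le_one)

text \<open>Each radius is a quarter of its centre, and a later centre is at most half of an earlier
  one. The later interval ends by 5/8 of the earlier centre, while the earlier interval starts at
  3/4 of it.\<close>

lemma dyadic_intervals_disjoint:
  fixes \<rho> t :: real
  assumes "0 < \<rho>" "M \<noteq> M'" "\<bar>t - \<rho> / 2 ^ Suc M\<bar> < \<rho> / 2 ^ (M + 3)"
  shows "\<rho> / 2 ^ (M' + 3) \<le> \<bar>t - \<rho> / 2 ^ Suc M'\<bar>"
proof -
  define h where "h = (\<lambda>M::nat. \<rho> / 2 ^ Suc M)"
  have h0: "0 < h N" for N using assms(1) by (simp add: h_def)
  have h4: "\<rho> / 2 ^ (N + 3) = h N / 4" for N by (simp add: h_def power_add)
  have half: "h N' \<le> h N / 2" if "N < N'" for N N'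
  proof -
    have "(2::real) ^ Suc (Suc N) \<le> 2 ^ Suc N'" using that by (intro power_increasing) auto
    then have "\<rho> / 2 ^ Suc N' \<le> \<rho> / 2 ^ Suc (Suc N)" using assms(1) by (intro divide_left_mono) auto
    then show ?thesis by (simp add: h_def)
  qed
  have t: "\<bar>t - h M\<bar> < h M / 4" using assms(3) unfolding h4 h_def .
  have "h M' / 4 \<le> \<bar>t - h M'\<bar>"
  proof (cases "M < M'")
    case True
    then show ?thesis using half[OF True] t h0[of M'] h0[of M] by linarith
  next
    case False
    then have "M' < M" using assms(2) by simp
    then show ?thesis using half[of M' M] t h0[of M'] h0[of M] by linarith
  qed
  then show ?thesis unfolding h4 by (simp add: h_def)
qed

text \<open>Each box gives the bound with a constant of its own; \<open>chi\<close> absorbs these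
  constants, leaving \<open>c = 1\<close> for all \<open>M\<close>. The empty set satisfies
  \<open>Ck_submanifold\<close> vacuously and contains no rational points, whence the hypothesis
  \<open>\<Sigma> \<noteq> {}\<close>.\<close>

theorem theorem6p5:
  fixes chi :: "nat \<Rightarrow> real" and \<Sigma> :: "(real^'n) set"
    and m k :: nat and \<epsilon> :: real
  assumes chi_pos: "\<forall>q\<ge>1. chi q > 0"
    and chi_lim: "filterlim chi at_top sequentially"
    and n_ge: "CARD('n) \<ge> 2"
    and m_ge: "1 \<le> m" and m_lt: "m < CARD('n)"
    and k_ge: "k \<ge> 2"
    and Sigma_mfd: "Ck_submanifold k m \<Sigma>"
    and Sigma_compact: "compact \<Sigma>"
    and Sigma_ne: "\<Sigma> \<noteq> {}"
    and eps_pos: "\<epsilon> > 0"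
  shows "\<exists>\<Sigma>' (q :: nat \<Rightarrow> nat) c.
           Ck_submanifold k m \<Sigma>' \<and> Ck_close k \<epsilon> \<Sigma> \<Sigma>' \<and>
           strict_mono q \<and> (\<forall>M. q M \<ge> 1) \<and> c > 0 \<and>
           (\<forall>M. real (card (rat_points (q M) \<Sigma>')) \<ge>
                 c * real (q M) powr (real (m * CARD('n)) / real (m + k * (CARD('n) - m)))
                   / chi (q M))"
proof -
  have "1 \<le> k" using k_ge by simp
  then obtain I x0 \<rho> where cardI: "card I = m" and \<rho>: "0 < \<rho>"
    and cov: "\<forall>y. (\<forall>i\<in>I. \<bar>y $ i - x0 $ i\<bar> < \<rho>) \<longrightarrow> (\<exists>\<sigma>\<in>\<Sigma>. \<forall>i\<in>I. \<sigma> $ i = y $ i)"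
    using Ck_submanifold_projection_contains_box[OF Sigma_mfd _ Sigma_ne] by metis
  have I: "I \<noteq> {}" "I \<noteq> UNIV" using cardI m_ge m_lt by auto
  have cardJ: "card (-I) = CARD('n) - m" using cardI by (simp add: Compl_eq_Diff_UNIV card_Diff_subset)
  define e where "e = real (m * CARD('n)) / real (m + k * (CARD('n) - m))"
  have e: "real (card I * (card I + card (-I))) / real (card I + k * card (-I)) = e"
    using m_lt by (simp add: e_def cardI cardJ)
  \<comment> \<open>Centres of boxes that shrink towards \<open>x0\<close>, shifted from it by
    \<open>\<rho> / 2 ^ Suc M\<close> in every coordinate. With half-side \<open>\<rho>' M\<close>
    the boxes lie inside the one of half-side \<rho> and are pairwise disjoint.\<close>
  define a where "a = (\<lambda>M::nat. x0 + (\<chi> i. \<rho> / 2 ^ Suc M))"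
  define \<rho>' where "\<rho>' = (\<lambda>M::nat. \<rho> / 2 ^ (M + 3))"
  \<comment> \<open>The total is \<open>\<epsilon> / 2\<close>, since \<open>Ck_close\<close> asks
    for a bound strictly below \<epsilon>.\<close>
  define \<delta> where "\<delta> = (\<lambda>M::nat. \<epsilon> / 2 * (1 / 2) ^ Suc M)"
  have sums\<delta>: "\<delta> sums (\<epsilon> / 2)"
    unfolding \<delta>_def using sums_mult[OF power_half_series, of "\<epsilon> / 2"] by simp
  define good where "good = (\<lambda>M (q::nat) g X. Ck_bound k (\<delta> M) g \<and>
      (\<forall>x y. (\<forall>i\<in>I. x $ i = y $ i) \<longrightarrow> g x = g y) \<and> (\<forall>x. \<forall>i\<in>I. g x $ i = 0) \<and>
      (\<forall>x. (\<exists>i\<in>I. \<rho>' M \<le> \<bar>x $ i - a M $ i\<bar>) \<longrightarrow> g x = 0) \<and>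
      finite X \<and> X \<subseteq> \<Sigma> \<and> (\<forall>x\<in>X. \<forall>i\<in>I. \<bar>x $ i - a M $ i\<bar> < \<rho>' M) \<and>
      (\<forall>x\<in>X. \<forall>i. \<exists>z::int. (x + g x) $ i = z / real q))"
  have "\<exists>Q. \<forall>q\<ge>Q. \<exists>g X. good M q g X \<and> real q powr e / chi q \<le> real (card X)" for M
  proof -
    have covM: "\<forall>y. (\<forall>i\<in>I. \<bar>y $ i - a M $ i\<bar> < \<rho>' M) \<longrightarrow> (\<exists>\<sigma>\<in>\<Sigma>. \<forall>i\<in>I. \<sigma> $ i = y $ i)"
    proof (intro allI impI, rule cov[rule_format])
      fix y i assume y: "\<forall>i\<in>I. \<bar>y $ i - a M $ i\<bar> < \<rho>' M" and "i \<in> I"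
      have "(1::real) \<le> 2 ^ M" by simp
      then have "\<rho> / 2 ^ M \<le> \<rho>" using \<rho> by (simp add: divide_le_eq mult_le_cancel_left1)
      moreover have "\<rho> / 2 ^ Suc M = (\<rho> / 2 ^ M) / 2" "\<rho>' M = (\<rho> / 2 ^ M) / 8"
        by (simp_all add: \<rho>'_def power_add)
      ultimately show "\<bar>y $ i - x0 $ i\<bar> < \<rho>"
        using bspec[OF y \<open>i \<in> I\<close>] \<rho> by (simp add: a_def)
    qed
    have pos: "0 < \<rho>' M" "0 < \<delta> M" using \<rho> eps_pos by (auto simp: \<rho>'_def \<delta>_def)
    obtain c Q where c: "0 < c" and Q: "\<And>q::nat. Q \<le> real q \<Longrightarrow> \<exists>g X. Ck_bound k (\<delta> M) g \<and>
      (\<forall>x y. (\<forall>i\<in>I. x $ i = y $ i) \<longrightarrow> g x = g y) \<and> (\<forall>x. \<forall>i\<in>I. g x $ i = 0) \<and>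
      (\<forall>x. (\<exists>i\<in>I. \<rho>' M \<le> \<bar>x $ i - a M $ i\<bar>) \<longrightarrow> g x = 0) \<and>
      finite X \<and> X \<subseteq> \<Sigma> \<and> (\<forall>x\<in>X. \<forall>i\<in>I. \<bar>x $ i - a M $ i\<bar> < \<rho>' M) \<and>
      (\<forall>x\<in>X. \<forall>i. \<exists>z::int. (x + g x) $ i = z / real q) \<and> c * real q powr e \<le> real (card X)"
      by (rule local_perturbation_with_rational_points[OF I k_ge pos covM, unfolded e]) (rule that)
    \<comment> \<open>The constant \<open>c\<close> belongs to the box, so the threshold for
      \<open>q\<close> can be chosen after it, with \<open>1 / chi q \<le> c\<close> from there
      on.\<close>
    have "eventually (\<lambda>q. 1 / c \<le> chi q) sequentially"
      using chi_lim by (simp add: filterlim_at_top)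
    then obtain q1 where q1: "\<And>q. q1 \<le> q \<Longrightarrow> 1 / c \<le> chi q"
      by (auto simp: eventually_sequentially)
    have "\<exists>g X. good M q g X \<and> real q powr e / chi q \<le> real (card X)" if q: "max q1 (nat \<lceil>Q\<rceil>) \<le> q" for q
    proof -
      have "Q \<le> real q" using q by linarith
      from Q[OF this] obtain g X where g: "good M q g X" "c * real q powr e \<le> real (card X)"
        unfolding good_def by blast
      have "1 / c \<le> chi q" using q q1 by simp
      moreover from this have "0 < chi q" using c by (meson less_le_trans zero_less_divide_1_iff)
      ultimately have "1 / chi q \<le> c" using c by (simp add: field_simps)
      then have "real q powr e / chi q \<le> c * real q powr e"
        using mult_right_mono[of "1 / chi q" c "real q powr e"] by simp
      with g show ?thesis by (meson order_trans)
    qed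
    then show ?thesis by blast
  qed
  then obtain Q where Q: "\<And>M q. Q M \<le> q \<Longrightarrow> \<exists>g X. good M q g X \<and> real q powr e / chi q \<le> real (card X)"
    by metis
  \<comment> \<open>Partial sums make \<open>q\<close> strictly increasing and \<open>q M\<close> at
    least \<open>Q M\<close>; \<open>Suc\<close> makes every term positive.\<close>
  define q where "q = (\<lambda>M. \<Sum>i\<le>M. Suc (Q i))"
  have qQ: "Q M \<le> q M" for M
    using member_le_sum[of M "{..M}" "\<lambda>i. Suc (Q i)"] by (simp add: q_def)
  have q1: "1 \<le> q M" for M unfolding q_def by (simp add: sum.atMost_shift Suc_leI)
  have "strict_mono q" unfolding strict_mono_Suc_iff by (simp add: q_def)
  obtain g X where good: "\<And>M. good M (q M) (g M) (X M)"
    and cardX: "\<And>M. real (q M) powr e / chi (q M) \<le> real (card (X M))"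
    using Q[OF qQ] by metis
  define G where "G = (\<lambda>x. \<Sum>M. g M x)"
  have boundG: "Ck_bound k (\<epsilon> / 2) G"
    unfolding G_def sums_unique[OF sums\<delta>]
    by (rule Ck_bound_suminf) (use sums\<delta> good in \<open>auto simp: good_def sums_iff\<close>)
  have G_cong: "G x = G y" if "\<And>i. i \<in> I \<Longrightarrow> x $ i = y $ i" for x y
  proof -
    have "g M x = g M y" for M using good[of M] that by (simp add: good_def)
    then show ?thesis by (simp add: G_def)
  qed
  have G_I: "G x $ i = 0" if "i \<in> I" for x i
  proof -
    have "Ck_bound k (\<delta> M) (g M)" for M using good[of M] by (simp add: good_def)
    then have "norm (g M x) \<le> \<delta> M" for M using Ck_bound_norm_le by blast
    then have "summable (\<lambda>M. g M x)"
      by (rule summable_comparison_test'[OF sums_summable[OF sums\<delta>]])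
    from bounded_linear.suminf[OF bounded_linear_vec_nth this]
    have "G x $ i = (\<Sum>M. g M x $ i)" by (simp add: G_def)
    moreover have "g M x $ i = 0" for M using good[of M] that by (simp add: good_def)
    ultimately show ?thesis by simp
  qed
  \<comment> \<open>Over the box with index \<open>M\<close> every other \<open>g M'\<close>
    vanishes, its box being disjoint from this one. A single coordinate of \<open>I\<close> detects
    it.\<close>
  have G_X: "G x = g M x" if x: "x \<in> X M" for x M
  proof -
    obtain i where i: "i \<in> I" using I(1) by blast
    have "g M' x = 0" if "M' \<notin> {M}" for M'
    proof -
      have "\<bar>(x $ i - x0 $ i) - \<rho> / 2 ^ Suc M\<bar> < \<rho> / 2 ^ (M + 3)"
        using good[of M] x i by (auto simp: good_def a_def \<rho>'_def diff_diff_eq)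
      then have "\<rho> / 2 ^ (M' + 3) \<le> \<bar>(x $ i - x0 $ i) - \<rho> / 2 ^ Suc M'\<bar>"
        using that by (intro dyadic_intervals_disjoint[OF \<rho>, of M M']) auto
      then have "\<exists>i\<in>I. \<rho>' M' \<le> \<bar>x $ i - a M' $ i\<bar>"
        using i by (auto simp: a_def \<rho>'_def diff_diff_eq)
      then show ?thesis using good[of M'] by (simp add: good_def)
    qed
    then have "(\<Sum>M. g M x) = (\<Sum>M\<in>{M}. g M x)" by (intro suminf_finite) auto
    then show ?thesis by (simp add: G_def)
  qed
  define \<Phi> where "\<Phi> = (\<lambda>x. x + G x)"
  have diffeo: "Ck_diffeo k UNIV UNIV \<Phi>"
    unfolding \<Phi>_def by (rule Ck_diffeo_shear[OF Ck_bound_imp_Ck_on[OF boundG] G_cong G_I])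
  then have inj: "inj \<Phi>" and cont: "continuous_on UNIV \<Phi>"
    by (auto simp: Ck_diffeo_def bij_is_inj Ck_on_imp_continuous_on)
  have "Ck_close k \<epsilon> \<Sigma> (\<Phi> ` \<Sigma>)"
    unfolding Ck_close_def
  proof (intro exI[of _ \<Phi>] conjI exI[of _ "\<epsilon> / 2"] allI impI diffeo refl)
    fix vs :: "(real^'n) list" and x assume vs: "length vs \<le> k" "\<forall>v\<in>set vs. norm v \<le> 1"
    have "norm (dderiv vs G x) \<le> \<epsilon> / 2 * prod_list (map norm vs)"
      by (rule Ck_bound_dderiv[OF boundG vs(1)])
    also have "prod_list (map norm vs) \<le> 1"
      by (rule prod_list_le_1[THEN conjunct2]) (use vs(2) in auto)
    finally have "norm (dderiv vs G x) \<le> \<epsilon> / 2" using eps_pos by simp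
    then show "norm (dderiv vs (\<lambda>y. \<Phi> y - y) x) \<le> \<epsilon> / 2" by (simp add: \<Phi>_def)
  qed (use eps_pos in simp)
  moreover have "real (card (rat_points (q M) (\<Phi> ` \<Sigma>))) \<ge> 1 * real (q M) powr e / chi (q M)" for M
  proof -
    have "compact (\<Phi> ` \<Sigma>)"
      using Sigma_compact cont by (intro compact_continuous_image continuous_on_subset[OF cont]) auto
    then have "finite (rat_points (q M) (\<Phi> ` \<Sigma>))" by (intro finite_rat_points compact_imp_bounded)
    moreover have "\<Phi> ` X M \<subseteq> rat_points (q M) (\<Phi> ` \<Sigma>)"
    proof
      fix y assume "y \<in> \<Phi> ` X M"
      then obtain x where x: "x \<in> X M" "y = \<Phi> x" by blast
      then have "y = x + g M x" using G_X by (simp add: \<Phi>_def)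
      moreover have "\<forall>i. \<exists>z::int. (x + g M x) $ i = z / real (q M)" and "x \<in> \<Sigma>"
        using good[of M] x(1) unfolding good_def by blast+
      moreover from this x(2) have "y \<in> \<Phi> ` \<Sigma>" by blast
      ultimately show "y \<in> rat_points (q M) (\<Phi> ` \<Sigma>)"
        unfolding rat_points_def by simp
    qed
    ultimately have "card (\<Phi> ` X M) \<le> card (rat_points (q M) (\<Phi> ` \<Sigma>))" by (rule card_mono)
    moreover have "card (\<Phi> ` X M) = card (X M)"
      using inj by (intro card_image) (auto intro: inj_on_subset)
    ultimately show ?thesis using cardX[of M] by simp
  qed
  ultimately show ?thesis
    using Ck_submanifold_diffeo_image[OF diffeo Sigma_mfd] \<open>strict_mono q\<close> q1 unfolding e_def
    by (intro exI[of _ "\<Phi> ` \<Sigma>"] exI[of _ q] exI[of _ 1]) auto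
qed

end
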